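(* For each $\alpha\in(\tfrac{\pi}{2},\tfrac{\pi}{2}+5.53\times10^{-3}]$ there is at most one (up to time translation) periodic solution $y\not\equiv0$, $y>-1$, of Wright's equation $y'(t)=-\alpha y(t-1)[1+y(t)]$ having a frequency $\omega$ with $|\omega-\tfrac{\pi}{2}|\le0.0924$ and satisfying $\|y'\|_{L^2([0,2\pi/\omega])}\le0.302$.
   Context: A periodic solution $y:\mathbb{R}\to\mathbb{R}$ has frequency $\omega>0$ if it is periodic with period $2\pi/\omega$. *)

theory Defs
  imports "HOL-Analysis.Analysis" "HOL-Library.Periodic_Fun"
begin

definition wright_solution :: "real \<Rightarrow> (real \<Rightarrow> real) \<Rightarrow> bool" where
  "wright_solution \<alpha> y \<longleftrightarrow>
     (\<forall>t. (y has_real_derivative (- \<alpha> * y (t - 1) * (1 + y t))) (at t))"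

(* 2 * pi / \<omega> is a period of y, not necessarily the minimal one. *)
definition has_frequency :: "(real \<Rightarrow> real) \<Rightarrow> real \<Rightarrow> bool" where
  "has_frequency y \<omega> \<longleftrightarrow> \<omega> > 0 \<and> periodic_fun_simple y (2 * pi / \<omega>)"

(* The integral is 0 by convention if f^2 is not integrable on S.  For the derivative of a
   solution of Wright's equation on a compact interval this cannot happen: a solution is
   continuous, hence so is its derivative. *)
definition L2_norm_on :: "real set \<Rightarrow> (real \<Rightarrow> real) \<Rightarrow> real" where
  "L2_norm_on S f = sqrt (LINT t:S|lborel. (f t)\<^sup>2)"

end

theory Submission
  imports Defs
begin

text \<open>
  Let \<open>c k\<close> be the Fourier coefficients of a solution of frequency \<open>\<omega>\<close>.  They satisfy
  \<open>L k * c k = - \<alpha> * N k\<close> with \<open>L k = \<i> k \<omega> + \<alpha> e\<^sup>-\<^sup>i\<^sup>k\<^sup>\<omega>\<close> and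
  \<open>N k = (\<Sum>j. c j e\<^sup>-\<^sup>i\<^sup>j\<^sup>\<omega> c (k - j))\<close>; integrating the logarithmic derivative of
  \<open>1 + y\<close> over a period gives \<open>c 0 = 0\<close>.  Bessel's inequality for \<open>y'\<close> makes the sequence
  small, and a time translation makes \<open>c 1 = \<epsilon> > 0\<close>.  Since \<open>L k\<close> is invertible for
  \<open>\<bar>k\<bar> \<ge> 2\<close>, the higher modes are quadratically small: \<open>c 2 = O(\<epsilon>\<^sup>2)\<close>, the modes
  \<open>\<bar>k\<bar> \<ge> 3\<close> are \<open>O(\<epsilon>\<^sup>3)\<close>, and the equation for \<open>k = 0\<close> forces \<open>\<omega>\<close>
  to be within \<open>O(\<epsilon>\<^sup>2)\<close> of \<open>\<pi> / 2\<close>.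

  For two solutions with amplitudes \<open>\<eta> \<le> \<epsilon>\<close> the differences of the modes \<open>k \<ge> 2\<close> are
  controlled by \<open>Y = \<epsilon>\<^sup>2 - \<eta>\<^sup>2\<close> and \<open>s = \<omega> - \<omega>'\<close>.  Subtracting the equations for
  \<open>k = 1\<close> and eliminating \<open>c 2\<close> leaves, up to a small multiple of \<open>Y + \<bar>s\<bar>\<close>, the relation
  \<open>s (- \<pi> / 2 + \<i> \<pi>) (- \<pi> / 2 + \<i>) = (\<pi>\<^sup>2 / 4) Y (1 + \<i>)\<close>.  The two complex numbers
  multiplying \<open>s\<close> and \<open>Y\<close> are linearly independent over the reals, so \<open>Y = s = 0\<close>.
\<close>

section \<open>Fourier coefficients of periodic functions\<close>

text \<open>The obstacle is that \<open>wright_symbol\<close> at \<open>k = 1\<close> vanishes for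
  \<alpha> = \<omega> = pi/2, the Hopf point, so the first mode cannot be estimated by inverting its
  symbol. Its equation is divided by the amplitude instead; as \<alpha> is common to both solutions,
  it then ties \<omega> to \<epsilon>^2. Because this relation is quadratic, amplitudes are compared
  through \<open>Y\<close>: a bare \<epsilon> - \<eta> could not be absorbed, and each one has to be
  paired with a factor \<epsilon>. A change of frequency moves the phase of mode j by up to |j|
  times that change, hence the weighted sum of |k| |c k|; Bessel's inequality does not bound it, the
  equation does. All numerical constants are rounded rationals that descend from the data: 0.302
  yields \<epsilon> \<le> 0.0701 and an l1 norm of at most 0.18, and the window 0.0924 starts a
  bootstrap after which \<omega> lies within 0.0047 of pi/2.\<close>

definition fmode :: "real \<Rightarrow> int \<Rightarrow> real \<Rightarrow> complex" where
  "fmode \<omega> k t = cis (of_int k * \<omega> * t)"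

definition fcoeff :: "real \<Rightarrow> (real \<Rightarrow> complex) \<Rightarrow> int \<Rightarrow> complex" where
  "fcoeff \<omega> f k = complex_of_real (\<omega> / (2 * pi)) * integral {0..2 * pi / \<omega>} (\<lambda>t. f t * fmode \<omega> (- k) t)"

lemma continuous_on_fmode [continuous_intros]: "continuous_on S (fmode \<omega> k)"
  unfolding fmode_def by (intro continuous_intros)

lemma norm_fmode [simp]: "norm (fmode \<omega> k t) = 1"
  by (simp add: fmode_def)

lemma fmode_mult: "fmode \<omega> k t * fmode \<omega> l t = fmode \<omega> (k + l) t"
  by (simp add: fmode_def cis_mult algebra_simps)

lemma fmode_0 [simp]: "fmode \<omega> 0 t = 1"
  by (simp add: fmode_def)

lemma cnj_fmode: "cnj (fmode \<omega> k t) = fmode \<omega> (- k) t"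
  by (simp add: fmode_def cis_cnj)

lemma fmode_has_vector_derivative:
  "(fmode \<omega> k has_vector_derivative (\<i> * of_int k * of_real \<omega> * fmode \<omega> k t)) (at t within S)"
proof -
  have "((\<lambda>z. exp (\<i> * (of_int k * of_real \<omega> * z))) has_field_derivative
      (\<i> * of_int k * of_real \<omega> * exp (\<i> * (of_int k * of_real \<omega> * of_real t)))) (at (of_real t))"
    by (auto intro!: derivative_eq_intros)
  from has_vector_derivative_real_field[OF this, of S] show ?thesis
    by (simp add: fmode_def[abs_def] cis_conv_exp mult.assoc)
qed

lemma fmode_period: "\<omega> \<noteq> 0 \<Longrightarrow> fmode \<omega> k (2 * pi / \<omega>) = 1"
  using cis_multiple_2pi[of "of_int k"] by (simp add: fmode_def mult.commute mult.left_commute)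

lemma integral_fmode:
  assumes "\<omega> > 0"
  shows "integral {0..2 * pi / \<omega>} (fmode \<omega> k) = (if k = 0 then of_real (2 * pi / \<omega>) else 0)"
proof (cases "k = 0")
  case True
  have "fmode \<omega> k = (\<lambda>t. 1)" using True by (auto simp: fmode_def)
  then show ?thesis using assms True by (simp add: scaleR_conv_of_real)
next
  case False
  define z where "z = \<i> * of_int k * complex_of_real \<omega>"
  have z: "z \<noteq> 0" using False assms by (simp add: z_def)
  define F where "F = (\<lambda>t. inverse z * fmode \<omega> k t)"
  have "(fmode \<omega> k has_integral (F (2 * pi / \<omega>) - F 0)) {0..2 * pi / \<omega>}"
  proof (rule fundamental_theorem_of_calculus)
    show "0 \<le> 2 * pi / \<omega>" using assms by simp
    fix x
    show "(F has_vector_derivative fmode \<omega> k x) (at x within {0..2 * pi / \<omega>})"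
      unfolding F_def
      using has_vector_derivative_mult_right[OF fmode_has_vector_derivative[of \<omega> k x, folded z_def], of "inverse z"] z
      by (simp flip: mult.assoc)
  qed
  moreover have "F (2 * pi / \<omega>) - F 0 = 0"
    using assms by (simp add: F_def fmode_period) (simp add: fmode_def)
  ultimately show ?thesis using False by (simp add: integral_unique)
qed

lemma fcoeff_integrable:
  "continuous_on UNIV f \<Longrightarrow> (\<lambda>t. f t * fmode \<omega> k t) integrable_on {a..b::real}"
  by (intro integrable_continuous_real continuous_intros) (auto elim: continuous_on_subset)

lemma fcoeff_add:
  "continuous_on UNIV f \<Longrightarrow> continuous_on UNIV g \<Longrightarrow>
    fcoeff \<omega> (\<lambda>t. f t + g t) k = fcoeff \<omega> f k + fcoeff \<omega> g k"
  by (simp add: fcoeff_def distrib_right distrib_left integral_add fcoeff_integrable)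

lemma fcoeff_diff:
  "continuous_on UNIV f \<Longrightarrow> continuous_on UNIV g \<Longrightarrow>
    fcoeff \<omega> (\<lambda>t. f t - g t) k = fcoeff \<omega> f k - fcoeff \<omega> g k"
  by (simp add: fcoeff_def left_diff_distrib right_diff_distrib integral_diff fcoeff_integrable)

lemma fcoeff_cmult: "fcoeff \<omega> (\<lambda>t. z * f t) k = z * fcoeff \<omega> f k"
  by (simp add: fcoeff_def mult.assoc)

lemma fcoeff_mult_fmode: "fcoeff \<omega> (\<lambda>t. f t * fmode \<omega> j t) k = fcoeff \<omega> f (k - j)"
  by (simp add: fcoeff_def mult.assoc fmode_mult)

lemma fcoeff_sum:
  assumes "finite F" "\<And>j. j \<in> F \<Longrightarrow> continuous_on UNIV (f j)"
  shows "fcoeff \<omega> (\<lambda>t. \<Sum>j\<in>F. f j t) k = (\<Sum>j\<in>F. fcoeff \<omega> (f j) k)"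
  using assms
proof (induction F rule: finite_induct)
  case empty
  then show ?case by (simp add: fcoeff_def)
next
  case (insert x F)
  then show ?case
    by (simp add: fcoeff_add continuous_on_sum)
qed

lemma fcoeff_1: "\<omega> > 0 \<Longrightarrow> fcoeff \<omega> (\<lambda>t. 1) k = (if k = 0 then 1 else 0)"
  using integral_fmode[of \<omega> "- k"] by (simp add: fcoeff_def flip: of_real_mult)

lemma norm_fcoeff_le:
  assumes "\<omega> > 0" "continuous_on UNIV f" "\<And>t. norm (f t) \<le> B"
  shows "norm (fcoeff \<omega> f k) \<le> B"
proof -
  have "norm (integral {0..2 * pi / \<omega>} (\<lambda>t. f t * fmode \<omega> (- k) t)) \<le> B * (2 * pi / \<omega> - 0)"
    using assms by (intro integral_bound continuous_intros) (auto simp: norm_mult elim: continuous_on_subset)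
  then have "\<omega> / (2 * pi) * norm (integral {0..2 * pi / \<omega>} (\<lambda>t. f t * fmode \<omega> (- k) t)) \<le> \<omega> / (2 * pi) * (B * (2 * pi / \<omega> - 0))"
    using assms by (intro mult_left_mono) auto
  also have "\<dots> = B" using assms by (simp add: field_simps)
  finally show ?thesis using assms by (simp add: fcoeff_def norm_mult norm_divide)
qed

text \<open>Expand the nonnegative integral of |f - p|^2, where \<open>p\<close> is the
  trigonometric polynomial with the coefficients of \<open>f\<close>: the integrals of
  \<open>f * cnj p\<close> and \<open>p * cnj p\<close> both equal the period times the sum on the
  left.\<close>

lemma bessel_inequality:
  assumes "\<omega> > 0" "continuous_on UNIV f" "finite F"
  shows "(\<Sum>k\<in>F. (norm (fcoeff \<omega> f k))\<^sup>2) \<le> \<omega> / (2 * pi) * integral {0..2 * pi / \<omega>} (\<lambda>t. (norm (f t))\<^sup>2)"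
proof -
  define T where "T = 2 * pi / \<omega>"
  have T: "T > 0" using assms by (simp add: T_def)
  define c where "c = fcoeff \<omega> f"
  define p where "p = (\<lambda>t. \<Sum>k\<in>F. c k * fmode \<omega> k t)"
  have cf: "continuous_on S f" for S using assms(2) continuous_on_subset by blast
  have cp: "continuous_on S p" for S unfolding p_def by (intro continuous_intros)
  have Re_int: "integral {0..T} (\<lambda>t. Re (q t)) = Re (integral {0..T} q)" if "continuous_on {0..T} q" for q
    using integral_linear[OF integrable_continuous_real[OF that] bounded_linear_Re] by (simp add: o_def)
  have I1: "integral {0..T} (\<lambda>t. f t * cnj (p t)) = of_real T * of_real (\<Sum>k\<in>F. (norm (c k))\<^sup>2)"
  proof -
    have "integral {0..T} (\<lambda>t. f t * cnj (p t)) = integral {0..T} (\<lambda>t. \<Sum>k\<in>F. cnj (c k) * (f t * fmode \<omega> (- k) t))"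
      by (intro integral_cong) (simp add: p_def cnj_sum cnj_fmode sum_distrib_left mult_ac)
    also have "\<dots> = (\<Sum>k\<in>F. integral {0..T} (\<lambda>t. cnj (c k) * (f t * fmode \<omega> (- k) t)))"
      by (intro integral_sum assms(3) integrable_on_mult_right fcoeff_integrable assms(2))
    also have "\<dots> = (\<Sum>k\<in>F. cnj (c k) * (of_real T * c k))"
      using assms(1) by (intro sum.cong) (auto simp: c_def fcoeff_def T_def)
    also have "\<dots> = of_real T * (\<Sum>k\<in>F. of_real ((norm (c k))\<^sup>2))"
      by (simp add: sum_distrib_left complex_norm_square mult_ac flip: of_real_power)
    finally show ?thesis by simp
  qed
  have I2: "integral {0..T} (\<lambda>t. p t * cnj (p t)) = of_real T * of_real (\<Sum>k\<in>F. (norm (c k))\<^sup>2)"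
  proof -
    have "integral {0..T} (\<lambda>t. p t * cnj (p t)) = integral {0..T} (\<lambda>t. \<Sum>k\<in>F. \<Sum>j\<in>F. c k * cnj (c j) * fmode \<omega> (k - j) t)"
    proof (intro integral_cong)
      fix t
      have "c k * fmode \<omega> k t * cnj (c j * fmode \<omega> j t) = c k * cnj (c j) * fmode \<omega> (k - j) t" for k j
        using fmode_mult[of \<omega> k t "- j"] by (simp add: cnj_fmode mult_ac)
      then show "p t * cnj (p t) = (\<Sum>k\<in>F. \<Sum>j\<in>F. c k * cnj (c j) * fmode \<omega> (k - j) t)"
        by (simp only: p_def cnj_sum sum_product)
    qed
    also have "\<dots> = (\<Sum>k\<in>F. integral {0..T} (\<lambda>t. \<Sum>j\<in>F. c k * cnj (c j) * fmode \<omega> (k - j) t))"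
      by (intro integral_sum assms(3) integrable_continuous_real continuous_intros)
    also have "\<dots> = (\<Sum>k\<in>F. \<Sum>j\<in>F. integral {0..T} (\<lambda>t. c k * cnj (c j) * fmode \<omega> (k - j) t))"
      by (intro sum.cong refl integral_sum assms(3) integrable_continuous_real continuous_intros)
    also have "\<dots> = (\<Sum>k\<in>F. \<Sum>j\<in>F. if j = k then c k * cnj (c k) * of_real T else 0)"
      using integral_fmode[OF assms(1)] by (intro sum.cong refl) (auto simp: T_def)
    also have "\<dots> = (\<Sum>k\<in>F. c k * cnj (c k) * of_real T)"
      using assms(3) by (intro sum.cong refl) (simp add: sum.delta)
    also have "\<dots> = of_real T * (\<Sum>k\<in>F. of_real ((norm (c k))\<^sup>2))"
      by (simp add: sum_distrib_left complex_norm_square mult_ac flip: of_real_power)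
    finally show ?thesis by simp
  qed
  have "0 \<le> integral {0..T} (\<lambda>t. (norm (f t - p t))\<^sup>2)"
    by (intro integral_nonneg integrable_continuous_real continuous_intros cf cp) auto
  also have "integral {0..T} (\<lambda>t. (norm (f t - p t))\<^sup>2) =
     integral {0..T} (\<lambda>t. (norm (f t))\<^sup>2 - 2 * Re (f t * cnj (p t)) + Re (p t * cnj (p t)))"
    by (intro integral_cong) (simp only: cmod_power2, simp add: power2_eq_square algebra_simps)
  also have "\<dots> = integral {0..T} (\<lambda>t. (norm (f t))\<^sup>2 - 2 * Re (f t * cnj (p t)))
      + integral {0..T} (\<lambda>t. Re (p t * cnj (p t)))"
    by (intro integral_add integrable_continuous_real continuous_intros cf cp)
  also have "integral {0..T} (\<lambda>t. (norm (f t))\<^sup>2 - 2 * Re (f t * cnj (p t)))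
     = integral {0..T} (\<lambda>t. (norm (f t))\<^sup>2) - integral {0..T} (\<lambda>t. 2 * Re (f t * cnj (p t)))"
    by (intro integral_diff integrable_continuous_real continuous_intros cf cp)
  also have "integral {0..T} (\<lambda>t. 2 * Re (f t * cnj (p t))) = 2 * integral {0..T} (\<lambda>t. Re (f t * cnj (p t)))"
    by (rule integral_mult_right)
  also have "integral {0..T} (\<lambda>t. Re (f t * cnj (p t))) = Re (integral {0..T} (\<lambda>t. f t * cnj (p t)))"
    by (intro Re_int continuous_intros cf cp)
  also have "integral {0..T} (\<lambda>t. Re (p t * cnj (p t))) = Re (integral {0..T} (\<lambda>t. p t * cnj (p t)))"
    by (intro Re_int continuous_intros cf cp)
  finally have "T * (\<Sum>k\<in>F. (norm (c k))\<^sup>2) \<le> integral {0..T} (\<lambda>t. (norm (f t))\<^sup>2)"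
    unfolding I1 I2 by (simp flip: of_real_mult)
  then show ?thesis using T assms(1) by (simp add: c_def T_def field_simps)
qed

section \<open>Coefficients of derivatives and products\<close>

lemma fcoeff_deriv:
  assumes "\<omega> > 0" "\<And>t. (f has_vector_derivative f' t) (at t)" "continuous_on UNIV f'"
    and "f (2 * pi / \<omega>) = f 0"
  shows "fcoeff \<omega> f' k = \<i> * of_int k * of_real \<omega> * fcoeff \<omega> f k"
proof -
  define T where "T = 2 * pi / \<omega>"
  have T: "T > 0" using assms by (simp add: T_def)
  have cf: "continuous_on UNIV f"
    using assms(2) has_vector_derivative_continuous by (blast intro: continuous_at_imp_continuous_on)
  have "((\<lambda>t. f t * (\<i> * of_int (-k) * of_real \<omega> * fmode \<omega> (-k) t) + f' t * fmode \<omega> (-k) t)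
     has_integral (f T * fmode \<omega> (-k) T - f 0 * fmode \<omega> (-k) 0)) {0..T}"
    using T by (intro fundamental_theorem_of_calculus has_vector_derivative_mult fmode_has_vector_derivative
        has_vector_derivative_at_within[OF assms(2)]) simp
  moreover have "f T * fmode \<omega> (-k) T - f 0 * fmode \<omega> (-k) 0 = 0"
    using assms T_def by (simp add: fmode_period) (simp add: fmode_def)
  ultimately have "0 = integral {0..T} (\<lambda>t. (\<i> * of_int (-k) * of_real \<omega>) * (f t * fmode \<omega> (-k) t) + f' t * fmode \<omega> (-k) t)"
    by (simp add: integral_unique mult_ac)
  also have "\<dots> = (\<i> * of_int (-k) * of_real \<omega>) * integral {0..T} (\<lambda>t. f t * fmode \<omega> (-k) t) + integral {0..T} (\<lambda>t. f' t * fmode \<omega> (-k) t)"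
    by (subst integral_add) (simp_all add: integrable_on_mult_right fcoeff_integrable cf assms(3) del: of_int_minus)
  finally have "integral {0..T} (\<lambda>t. f' t * fmode \<omega> (-k) t) = \<i> * of_int k * of_real \<omega> * integral {0..T} (\<lambda>t. f t * fmode \<omega> (-k) t)"
    by (simp add: eq_neg_iff_add_eq_0)
  then show ?thesis by (simp add: fcoeff_def T_def)
qed

text \<open>Replacing the series of \<open>g\<close> by a finite part costs at most \<open>B\<close>
  times the remaining sum of \<open>norm (d j)\<close>, uniformly in \<open>t\<close>; for a finite
  part the claim is linearity together with the index shift
  \<open>fcoeff_mult_fmode\<close>.\<close>

lemma fcoeff_mult_has_sum:
  assumes "\<omega> > 0" "continuous_on UNIV f" "continuous_on UNIV g" "\<And>t. norm (f t) \<le> B"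
    and "(\<lambda>j. norm (d j)) summable_on UNIV" "\<And>t. ((\<lambda>j. d j * fmode \<omega> j t) has_sum g t) UNIV"
  shows "((\<lambda>j. d j * fcoeff \<omega> f (k - j)) has_sum fcoeff \<omega> (\<lambda>t. f t * g t) k) UNIV"
proof -
  have B: "B \<ge> 0" by (rule order_trans[OF norm_ge_zero assms(4)])
  have bound: "norm (fcoeff \<omega> (\<lambda>t. f t * g t) k - (\<Sum>j\<in>F. d j * fcoeff \<omega> f (k - j)))
     \<le> B * (infsum (\<lambda>j. norm (d j)) UNIV - (\<Sum>j\<in>F. norm (d j)))" if F: "finite F" for F
  proof -
    have ns: "(\<lambda>j. norm (d j)) summable_on (- F)" by (rule summable_on_subset_banach[OF assms(5)]) simp
    have eq: "infsum (\<lambda>j. norm (d j)) (- F) = infsum (\<lambda>j. norm (d j)) UNIV - (\<Sum>j\<in>F. norm (d j))"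
      using infsum_Diff[of "\<lambda>j. norm (d j)" UNIV F] assms(5) F by (simp add: Compl_eq_Diff_UNIV)
    have "(\<Sum>j\<in>F. d j * fcoeff \<omega> f (k - j)) = (\<Sum>j\<in>F. fcoeff \<omega> (\<lambda>t. d j * (f t * fmode \<omega> j t)) k)"
      by (simp only: fcoeff_cmult fcoeff_mult_fmode)
    also have "\<dots> = fcoeff \<omega> (\<lambda>t. \<Sum>j\<in>F. d j * (f t * fmode \<omega> j t)) k"
      using F assms(2) by (subst fcoeff_sum) (auto intro!: continuous_intros)
    finally have "fcoeff \<omega> (\<lambda>t. f t * g t) k - (\<Sum>j\<in>F. d j * fcoeff \<omega> f (k - j))
        = fcoeff \<omega> (\<lambda>t. f t * g t - (\<Sum>j\<in>F. d j * (f t * fmode \<omega> j t))) k"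
      using assms(2,3) by (subst fcoeff_diff) (auto intro!: continuous_intros)
    also have "norm \<dots> \<le> B * infsum (\<lambda>j. norm (d j)) (- F)"
    proof (rule norm_fcoeff_le[OF assms(1)])
      show "continuous_on UNIV (\<lambda>t. f t * g t - (\<Sum>j\<in>F. d j * (f t * fmode \<omega> j t)))"
        using assms(2,3) by (intro continuous_intros)
      fix t
      have "((\<lambda>j. d j * fmode \<omega> j t) has_sum (g t - (\<Sum>j\<in>F. d j * fmode \<omega> j t))) (UNIV - F)"
        using F assms(6) by (intro has_sum_Diff has_sum_finite) auto
      then have "g t - (\<Sum>j\<in>F. d j * fmode \<omega> j t) = infsum (\<lambda>j. d j * fmode \<omega> j t) (- F)"
        by (simp add: infsumI Compl_eq_Diff_UNIV)
      also have "norm \<dots> \<le> infsum (\<lambda>j. norm (d j)) (- F)"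
        using norm_infsum_bound[of "\<lambda>j. d j * fmode \<omega> j t" "- F"] ns by (simp add: norm_mult)
      finally have "norm (f t) * norm (g t - (\<Sum>j\<in>F. d j * fmode \<omega> j t)) \<le> B * infsum (\<lambda>j. norm (d j)) (- F)"
        using assms(4) B by (intro mult_mono) auto
      moreover have "f t * g t - (\<Sum>j\<in>F. d j * (f t * fmode \<omega> j t)) = f t * (g t - (\<Sum>j\<in>F. d j * fmode \<omega> j t))"
        by (simp add: sum_distrib_left algebra_simps)
      ultimately show "norm (f t * g t - (\<Sum>j\<in>F. d j * (f t * fmode \<omega> j t))) \<le> B * infsum (\<lambda>j. norm (d j)) (- F)"
        by (simp add: norm_mult)
    qed
    finally show ?thesis using eq by simp
  qed
  have "((\<lambda>F. B * (infsum (\<lambda>j. norm (d j)) UNIV - (\<Sum>j\<in>F. norm (d j)))) \<longlongrightarrow> B * (infsum (\<lambda>j. norm (d j)) UNIV - infsum (\<lambda>j. norm (d j)) UNIV)) (finite_subsets_at_top UNIV)"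
    using assms(5) by (intro tendsto_intros infsum_tendsto)
  then have lim0: "((\<lambda>F. B * (infsum (\<lambda>j. norm (d j)) UNIV - (\<Sum>j\<in>F. norm (d j)))) \<longlongrightarrow> 0) (finite_subsets_at_top UNIV)"
    by simp
  have "((\<lambda>F. (\<Sum>j\<in>F. d j * fcoeff \<omega> f (k - j)) - fcoeff \<omega> (\<lambda>t. f t * g t) k) \<longlongrightarrow> 0) (finite_subsets_at_top UNIV)"
    proof (rule Lim_null_comparison[OF _ lim0], rule eventually_finite_subsets_at_top_weakI)
    fix F :: "int set" assume "finite F"
    from bound[OF this] show "norm ((\<Sum>j\<in>F. d j * fcoeff \<omega> f (k - j)) - fcoeff \<omega> (\<lambda>t. f t * g t) k)
      \<le> B * (infsum (\<lambda>j. norm (d j)) UNIV - (\<Sum>j\<in>F. norm (d j)))"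
      by (simp only: norm_minus_commute)
  qed
  then show ?thesis unfolding has_sum_def by (simp add: LIM_zero_iff)
qed

text \<open>The product formula with \<open>f = 1\<close>, where every term except
  \<open>j = k\<close> vanishes. It identifies the coefficients of the delayed function, whose
  series is known pointwise.\<close>

lemma fcoeff_of_series:
  assumes "\<omega> > 0" "continuous_on UNIV g"
    and "(\<lambda>j. norm (d j)) summable_on UNIV" "\<And>t. ((\<lambda>j. d j * fmode \<omega> j t) has_sum g t) UNIV"
  shows "fcoeff \<omega> g k = d k"
proof -
  have "((\<lambda>j. d j * fcoeff \<omega> (\<lambda>t. 1) (k - j)) has_sum fcoeff \<omega> (\<lambda>t. 1 * g t) k) UNIV"
    by (rule fcoeff_mult_has_sum[OF assms(1) _ assms(2) _ assms(3,4), of _ 1]) auto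
  moreover have "((\<lambda>j. d j * fcoeff \<omega> (\<lambda>t. 1) (k - j)) has_sum d k) UNIV"
    using assms(1) by (intro has_sum_finite_neutralI[of "{k}"]) (auto simp: fcoeff_1)
  ultimately show ?thesis by (simp add: has_sum_unique)
qed

section \<open>Pointwise Fourier inversion\<close>

lemma filterlim_symmetric_intervals:
  "filterlim (\<lambda>n. {- int n..int n}) (finite_subsets_at_top UNIV) sequentially"
  unfolding filterlim_finite_subsets_at_top
proof safe
  fix X :: "int set" assume "finite X"
  define M where "M = nat (Max (insert 0 (abs ` X)))"
  have "\<bar>x\<bar> \<le> int M" if "x \<in> X" for x
    using \<open>finite X\<close> that unfolding M_def by (subst int_nat_eq) auto
  then have "X \<subseteq> {- int n..int n}" if "n \<ge> M" for n
  proof (intro subsetI)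
    fix x assume "x \<in> X"
    with \<open>\<And>x. x \<in> X \<Longrightarrow> \<bar>x\<bar> \<le> int M\<close> have "\<bar>x\<bar> \<le> int M" by blast
    with that show "x \<in> {- int n..int n}" by auto
  qed
  then show "\<forall>\<^sub>F n in sequentially. finite {- int n..int n} \<and> X \<subseteq> {- int n..int n} \<and> {- int n..int n} \<subseteq> UNIV"
    unfolding eventually_sequentially by (intro exI[of _ M]) auto
qed

text \<open>The Riemann-Lebesgue lemma for continuous functions: by Bessel the squared norms are
  summable along each half line.\<close>

lemma fcoeff_tendsto_0:
  assumes "\<omega> > 0" "continuous_on UNIV f"
  shows "(\<lambda>n. fcoeff \<omega> f (int n)) \<longlonglongrightarrow> 0" "(\<lambda>n. fcoeff \<omega> f (- int n)) \<longlonglongrightarrow> 0"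
proof -
  have "(\<lambda>n. fcoeff \<omega> f (s * int n)) \<longlonglongrightarrow> 0" if s: "s = 1 \<or> s = -1" for s
  proof -
    have "summable (\<lambda>n. (norm (fcoeff \<omega> f (s * int n)))\<^sup>2)"
    proof (rule bounded_imp_summable)
      fix n
      have "(\<Sum>k\<le>n. (norm (fcoeff \<omega> f (s * int k)))\<^sup>2) = (\<Sum>k\<in>(\<lambda>k. s * int k) ` {..n}. (norm (fcoeff \<omega> f k))\<^sup>2)"
        using s by (subst sum.reindex) (auto simp: inj_on_def)
      also have "\<dots> \<le> \<omega> / (2 * pi) * integral {0..2 * pi / \<omega>} (\<lambda>t. (norm (f t))\<^sup>2)"
        by (rule bessel_inequality[OF assms]) auto
      finally show "(\<Sum>k\<le>n. (norm (fcoeff \<omega> f (s * int k)))\<^sup>2) \<le> \<omega> / (2 * pi) * integral {0..2 * pi / \<omega>} (\<lambda>t. (norm (f t))\<^sup>2)" .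
    qed auto
    then have "(\<lambda>n. (norm (fcoeff \<omega> f (s * int n)))\<^sup>2) \<longlonglongrightarrow> 0"
      by (rule summable_LIMSEQ_zero)
    then have "(\<lambda>n. sqrt ((norm (fcoeff \<omega> f (s * int n)))\<^sup>2)) \<longlonglongrightarrow> sqrt 0"
      by (rule tendsto_real_sqrt)
    then show ?thesis by (simp add: tendsto_norm_zero_iff)
  qed
  from this[of 1] this[of "-1"] show "(\<lambda>n. fcoeff \<omega> f (int n)) \<longlonglongrightarrow> 0" "(\<lambda>n. fcoeff \<omega> f (- int n)) \<longlonglongrightarrow> 0"
    by simp_all
qed

lemma has_vector_derivative_quotient:
  assumes "(f has_vector_derivative d) (at t)"
  shows "((\<lambda>s. (f s - f t) /\<^sub>R (s - t)) \<longlongrightarrow> d) (at t)"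
proof -
  have "((\<lambda>s. norm ((f s - f t - (s - t) *\<^sub>R d) /\<^sub>R norm (s - t))) \<longlongrightarrow> 0) (at t)"
    using assms unfolding has_vector_derivative_def has_derivative_at_within
    by (intro tendsto_norm_zero) auto
  moreover have "eventually (\<lambda>s. norm ((f s - f t - (s - t) *\<^sub>R d) /\<^sub>R norm (s - t)) = norm ((f s - f t) /\<^sub>R (s - t) - d)) (at t)"
    unfolding eventually_at_filter
  proof (intro always_eventually allI impI)
    fix s assume "s \<noteq> t"
    then have "(f s - f t) /\<^sub>R (s - t) - d = (f s - f t - (s - t) *\<^sub>R d) /\<^sub>R (s - t)"
      by (simp add: scaleR_diff_right)
    then show "norm ((f s - f t - (s - t) *\<^sub>R d) /\<^sub>R norm (s - t)) = norm ((f s - f t) /\<^sub>R (s - t) - d)"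
      by simp
  qed
  ultimately have "((\<lambda>s. norm ((f s - f t) /\<^sub>R (s - t) - d)) \<longlongrightarrow> 0) (at t)"
    by (rule Lim_transform_eventually)
  then show ?thesis by (simp add: tendsto_norm_zero_iff LIM_zero_iff)
qed

text \<open>The factor vanishes only at the translates of \<open>t0\<close> by whole periods, where
  \<open>f t - f t0\<close> vanishes as well. At these points the factor has the nonzero derivative
  \<open>\<i> * of_real \<omega>\<close>, so the singularities of the quotient are
  removable.\<close>

lemma difference_quotient_continuous:
  fixes t0 :: real
  assumes "\<omega> > 0" "\<And>t. (f has_vector_derivative f' t) (at t)" "\<And>t. f (t + 2 * pi / \<omega>) = f t"
  obtains g where "continuous_on UNIV g" and "\<And>t. f t - f t0 = g t * (fmode \<omega> 1 (t - t0) - 1)"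
proof
  define e where "e = (\<lambda>t. fmode \<omega> 1 (t - t0) - 1)"
  define g where "g = (\<lambda>t. if e t = 0 then f' t / (\<i> * of_real \<omega>) else (f t - f t0) / e t)"
  interpret periodic_fun_simple f "2 * pi / \<omega>" by unfold_locales (rule assms(3))
  have zero: "f t = f t0" if "e t = 0" for t
  proof -
    have "cis (\<omega> * (t - t0)) = 1" using that by (simp add: e_def fmode_def)
    then have "cos (\<omega> * (t - t0)) = 1" by (metis cis.simps(1) one_complex.simps(1))
    then obtain n :: int where "\<omega> * (t - t0) = of_int n * 2 * pi" unfolding cos_one_2pi_int by blast
    then have "t = t0 + of_int n * (2 * pi / \<omega>)" using assms(1) by (simp add: field_simps)
    then show ?thesis by (simp only: plus_of_int)
  qed
  show "f t - f t0 = g t * (fmode \<omega> 1 (t - t0) - 1)" for t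
  proof -
    have "f t - f t0 = g t * e t" using zero[of t] by (simp add: g_def)
    then show ?thesis by (simp add: e_def)
  qed
  have de: "(e has_vector_derivative (\<i> * of_real \<omega> * fmode \<omega> 1 (t - t0))) (at t)" for t
  proof -
    have eq: "fmode \<omega> 1 (t - t0) = fmode \<omega> 1 (- t0) * fmode \<omega> 1 t" for t
      by (simp add: fmode_def cis_mult algebra_simps)
    have "((\<lambda>t. fmode \<omega> 1 (- t0) * fmode \<omega> 1 t) has_vector_derivative
        fmode \<omega> 1 (- t0) * (\<i> * of_int 1 * of_real \<omega> * fmode \<omega> 1 t)) (at t)"
      by (intro has_vector_derivative_mult_right fmode_has_vector_derivative)
    then show ?thesis
      unfolding e_def eq by (simp add: has_vector_derivative_diff_const mult_ac)
  qed
  have ce: "isCont e t" for t using de[of t] by (rule has_vector_derivative_continuous)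
  have cf: "isCont f t" for t using assms(2)[of t] by (rule has_vector_derivative_continuous)
  have "isCont g t" for t
  proof (cases "e t = 0")
    case False
    have "isCont (\<lambda>s. (f s - f t0) / e s) t" using False ce cf by (intro continuous_intros)
    moreover have "eventually (\<lambda>s. e s \<noteq> 0) (at t)"
      using ce[of t] False unfolding isCont_def by (rule tendsto_imp_eventually_ne)
    then have "eventually (\<lambda>s. (f s - f t0) / e s = g s) (at t)"
      by eventually_elim (simp add: g_def)
    ultimately show ?thesis
      using False unfolding isCont_def by (simp add: g_def tendsto_cong)
  next
    case True
    have fm: "fmode \<omega> 1 (t - t0) = 1" using True by (simp add: e_def)
    have q1: "((\<lambda>s. (f s - f t) /\<^sub>R (s - t)) \<longlongrightarrow> f' t) (at t)"
      by (rule has_vector_derivative_quotient[OF assms(2)])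
    have q2: "((\<lambda>s. (e s - e t) /\<^sub>R (s - t)) \<longlongrightarrow> \<i> * of_real \<omega>) (at t)"
      using has_vector_derivative_quotient[OF de[of t]] by (simp add: fm)
    have lim: "((\<lambda>s. ((f s - f t) /\<^sub>R (s - t)) / ((e s - e t) /\<^sub>R (s - t))) \<longlongrightarrow> f' t / (\<i> * of_real \<omega>)) (at t)"
      using assms(1) by (intro tendsto_divide q1 q2) auto
    have "eventually (\<lambda>s. (e s - e t) /\<^sub>R (s - t) \<noteq> 0) (at t)"
      using q2 by (rule tendsto_imp_eventually_ne) (use assms(1) in auto)
    then have "eventually (\<lambda>s. ((f s - f t) /\<^sub>R (s - t)) / ((e s - e t) /\<^sub>R (s - t)) = g s) (at t)"
    proof eventually_elim
      case (elim s)
      then have s: "s \<noteq> t" "e s \<noteq> 0" using True by auto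
      have "(a /\<^sub>R (s - t)) / (b /\<^sub>R (s - t)) = a / b" for a b :: complex
        using s by (simp add: scaleR_conv_of_real del: of_real_diff of_real_inverse)
      then show ?case using s True zero[of t] by (simp add: g_def)
    qed
    from lim this have "(g \<longlongrightarrow> f' t / (\<i> * of_real \<omega>)) (at t)"
      by (rule Lim_transform_eventually)
    then show ?thesis using True by (simp add: isCont_def g_def)
  qed
  then show "continuous_on UNIV g" by (simp add: continuous_on_eq_continuous_at)
qed

text \<open>Chernoff's argument: writing \<open>f t - f t0 = g t * (fmode \<omega> 1 (t - t0) - 1)\<close> makes the
  symmetric partial sums of the Fourier series of \<open>f - f t0\<close> at \<open>t0\<close> telescope.\<close>
lemma fourier_inversion:
  assumes "\<omega> > 0" "\<And>t. (f has_vector_derivative f' t) (at t)" "\<And>t. f (t + 2 * pi / \<omega>) = f t"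
    and "(\<lambda>k. norm (fcoeff \<omega> f k)) summable_on UNIV"
  shows "((\<lambda>k. fcoeff \<omega> f k * fmode \<omega> k t0) has_sum f t0) UNIV"
proof -
  obtain g where cg: "continuous_on UNIV g" and fg: "\<And>t. f t - f t0 = g t * (fmode \<omega> 1 (t - t0) - 1)"
    using difference_quotient_continuous[OF assms(1-3)] by blast
  have cf: "continuous_on UNIV f"
    using assms(2) has_vector_derivative_continuous by (blast intro: continuous_at_imp_continuous_on)
  define h where "h = (\<lambda>k. fcoeff \<omega> g k * fmode \<omega> k t0)"
  \<comment> \<open>Multiplication by \<open>fmode \<omega> 1\<close> shifts the coefficients of
    \<open>g\<close> by one index, which turns the factorization into a difference; subtracting the
    constant \<open>f t0\<close> only affects \<open>k = 0\<close>.\<close>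
  have rec: "fcoeff \<omega> f k * fmode \<omega> k t0 - (if k = 0 then f t0 else 0) = h (k - 1) - h k" for k
  proof -
    have "fcoeff \<omega> f k - f t0 * (if k = 0 then 1 else 0) = fcoeff \<omega> (\<lambda>t. f t - f t0 * 1) k"
      using cf assms(1) by (subst fcoeff_diff) (auto simp only: fcoeff_cmult fcoeff_1 continuous_on_const)
    also have "(\<lambda>t. f t - f t0 * 1) = (\<lambda>t. fmode \<omega> (-1) t0 * (g t * fmode \<omega> 1 t) - g t)"
    proof
      fix t
      have "fmode \<omega> 1 (t - t0) = fmode \<omega> (-1) t0 * fmode \<omega> 1 t"
        by (simp add: fmode_def cis_mult algebra_simps)
      then show "f t - f t0 * 1 = fmode \<omega> (-1) t0 * (g t * fmode \<omega> 1 t) - g t"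
        using fg[of t] by (simp add: algebra_simps)
    qed
    also have "fcoeff \<omega> \<dots> k = fmode \<omega> (-1) t0 * fcoeff \<omega> g (k - 1) - fcoeff \<omega> g k"
      using cg by (subst fcoeff_diff) (auto simp only: fcoeff_cmult fcoeff_mult_fmode intro!: continuous_intros)
    finally have "(fcoeff \<omega> f k - f t0 * (if k = 0 then 1 else 0)) * fmode \<omega> k t0
       = (fmode \<omega> (-1) t0 * fcoeff \<omega> g (k - 1) - fcoeff \<omega> g k) * fmode \<omega> k t0" by simp
    also have "\<dots> = fcoeff \<omega> g (k - 1) * (fmode \<omega> (-1) t0 * fmode \<omega> k t0) - fcoeff \<omega> g k * fmode \<omega> k t0"
      by (simp add: algebra_simps)
    also have "fmode \<omega> (-1) t0 * fmode \<omega> k t0 = fmode \<omega> (k - 1) t0"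
      by (simp add: fmode_mult)
    finally show ?thesis by (cases "k = 0") (simp_all add: h_def left_diff_distrib)
  qed
  have tele: "(\<Sum>k\<in>{- int n..int n}. h (k - 1) - h k) = h (- int n - 1) - h (int n)" for n
  proof (induction n)
    case (Suc n)
    have "{- int (Suc n)..int (Suc n)} = insert (- int (Suc n)) (insert (int (Suc n)) {- int n..int n})" by auto
    moreover have "h (- int n - 1) = h (- 1 - int n)" by (rule arg_cong[of _ _ h]) simp
    ultimately show ?case using Suc by (simp add: algebra_simps)
  qed simp
  \<comment> \<open>Absolute summability gives the series some value \<open>S\<close>; the
    telescoped symmetric sums tend to 0, because the coefficients of \<open>g\<close> do, and this
    identifies \<open>S\<close> as \<open>f t0\<close>.\<close>
  define S where "S = infsum (\<lambda>k. fcoeff \<omega> f k * fmode \<omega> k t0) UNIV"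
  have hs: "((\<lambda>k. fcoeff \<omega> f k * fmode \<omega> k t0) has_sum S) UNIV"
    unfolding S_def by (rule has_sum_infsum, rule abs_summable_summable) (simp add: norm_mult assms(4))
  have "((\<lambda>k. fcoeff \<omega> f k * fmode \<omega> k t0 - (if k = 0 then f t0 else 0)) has_sum (S - f t0)) UNIV"
  proof -
    have "((\<lambda>k. - (if k = 0 then f t0 else 0)) has_sum - f t0) (UNIV :: int set)"
      by (intro has_sum_finite_neutralI[of "{0}"]) auto
    from has_sum_add[OF hs this] show ?thesis by simp
  qed
  then have "((\<lambda>k. h (k - 1) - h k) has_sum (S - f t0)) UNIV" by (simp add: rec)
  then have "(\<lambda>n. \<Sum>k\<in>{- int n..int n}. h (k - 1) - h k) \<longlonglongrightarrow> S - f t0"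
    unfolding has_sum_def by (rule filterlim_compose[OF _ filterlim_symmetric_intervals])
  moreover have "(\<lambda>n. h (- int n - 1) - h (int n)) \<longlonglongrightarrow> 0 - 0"
  proof (intro tendsto_diff)
    have eq: "- int (Suc n) = - int n - 1" for n by simp
    have "(\<lambda>n. fcoeff \<omega> g (- int (Suc n))) \<longlonglongrightarrow> 0"
      using fcoeff_tendsto_0(2)[OF assms(1) cg] by (rule LIMSEQ_Suc)
    then have "(\<lambda>n. fcoeff \<omega> g (- int n - 1)) \<longlonglongrightarrow> 0" unfolding eq .
    then have "(\<lambda>n. norm (h (- int n - 1))) \<longlonglongrightarrow> 0"
      by (simp add: h_def norm_mult tendsto_norm_zero_iff)
    then show "(\<lambda>n. h (- int n - 1)) \<longlonglongrightarrow> 0" by (simp add: tendsto_norm_zero_iff)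
    have "(\<lambda>n. norm (h (int n))) \<longlonglongrightarrow> 0"
      using fcoeff_tendsto_0(1)[OF assms(1) cg] by (simp add: h_def norm_mult tendsto_norm_zero_iff)
    then show "(\<lambda>n. h (int n)) \<longlonglongrightarrow> 0" by (simp add: tendsto_norm_zero_iff)
  qed
  ultimately have "S - f t0 = 0 - 0" unfolding tele by (rule LIMSEQ_unique)
  with hs show ?thesis by simp
qed

section \<open>The equation in Fourier space\<close>

definition wright_symbol :: "real \<Rightarrow> real \<Rightarrow> int \<Rightarrow> complex" where
  "wright_symbol \<alpha> \<omega> k = \<i> * of_real (of_int k * \<omega>) + of_real \<alpha> * cis (- of_int k * \<omega>)"

definition delay_conv :: "real \<Rightarrow> (int \<Rightarrow> complex) \<Rightarrow> int \<Rightarrow> complex" where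
  "delay_conv \<omega> c k = (\<Sum>\<^sub>\<infinity>j. c j * cis (- of_int j * \<omega>) * c (k - j))"

text \<open>All that the comparison keeps of a solution. The symmetry encodes that \<open>y\<close>
  is real, \<open>c 0 = 0\<close> that its mean vanishes. Summability makes
  \<open>delay_conv\<close> a genuine sum, since \<open>infsum\<close> is 0 by convention for
  families that are not summable.\<close>

definition wright_coeffs :: "real \<Rightarrow> real \<Rightarrow> (int \<Rightarrow> complex) \<Rightarrow> bool" where
  "wright_coeffs \<alpha> \<omega> c \<longleftrightarrow>
     (\<forall>k. c (- k) = cnj (c k)) \<and> c 0 = 0 \<and> (\<lambda>k. norm (c k)) summable_on UNIV \<and>
     (\<forall>k. wright_symbol \<alpha> \<omega> k * c k = - of_real \<alpha> * delay_conv \<omega> c k)"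

lemma sum_inverse_squares_nat_le:
  assumes "finite P" "\<And>k. k \<in> P \<Longrightarrow> (k::nat) > 0"
  shows "(\<Sum>k\<in>P. 1 / (real k)\<^sup>2) \<le> pi\<^sup>2 / 6"
proof -
  have inj: "inj_on (\<lambda>k. k - 1) P"
  proof (rule inj_onI)
    fix x y assume "x \<in> P" "y \<in> P" "x - 1 = y - 1"
    with assms(2)[of x] assms(2)[of y] show "x = y" by linarith
  qed
  have "(\<Sum>k\<in>P. 1 / (real k)\<^sup>2) = (\<Sum>n\<in>(\<lambda>k. k - 1) ` P. 1 / (real n + 1)\<^sup>2)"
    using assms(2) by (subst sum.reindex[OF inj]) (auto simp: of_nat_diff Suc_le_eq intro!: sum.cong)
  also have "\<dots> \<le> (\<Sum>n. 1 / (real n + 1)\<^sup>2)"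
    using inverse_squares_sums assms(1) by (intro sum_le_suminf) (auto simp: sums_iff add.commute)
  also have "\<dots> = pi\<^sup>2 / 6"
    using inverse_squares_sums by (simp add: sums_iff add.commute)
  finally show ?thesis .
qed

lemma sum_inverse_squares_int_le:
  assumes "finite F" "(0::int) \<notin> F"
  shows "(\<Sum>k\<in>F. 1 / (of_int k)\<^sup>2) \<le> pi\<^sup>2 / 3"
proof -
  define P where "P = nat ` {k \<in> F. k > 0}"
  define N where "N = (\<lambda>k. nat (- k)) ` {k \<in> F. k < 0}"
  have F: "F = {k \<in> F. k > 0} \<union> {k \<in> F. k < 0}"
  proof (intro set_eqI iffI)
    fix k assume "k \<in> F"
    moreover from this have "k \<noteq> 0" using assms(2) by blast
    ultimately show "k \<in> {k \<in> F. k > 0} \<union> {k \<in> F. k < 0}" by auto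
  qed auto
  have "(\<Sum>k\<in>F. 1 / (of_int k)\<^sup>2) = (\<Sum>k\<in>{k \<in> F. k > 0}. 1 / (real_of_int k)\<^sup>2) + (\<Sum>k\<in>{k \<in> F. k < 0}. 1 / (real_of_int k)\<^sup>2)"
    by (subst F, rule sum.union_disjoint) (use assms(1) in auto)
  also have "(\<Sum>k\<in>{k \<in> F. k > 0}. 1 / (real_of_int k)\<^sup>2) = (\<Sum>k\<in>P. 1 / (real k)\<^sup>2)"
    unfolding P_def by (subst sum.reindex) (auto simp: inj_on_def)
  also have "(\<Sum>k\<in>{k \<in> F. k < 0}. 1 / (real_of_int k)\<^sup>2) = (\<Sum>k\<in>N. 1 / (real k)\<^sup>2)"
    unfolding N_def by (subst sum.reindex) (auto simp: inj_on_def)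
  also have "(\<Sum>k\<in>P. 1 / (real k)\<^sup>2) \<le> pi\<^sup>2 / 6"
    using assms(1) by (intro sum_inverse_squares_nat_le) (auto simp: P_def)
  also have "(\<Sum>k\<in>N. 1 / (real k)\<^sup>2) \<le> pi\<^sup>2 / 6"
    using assms(1) by (intro sum_inverse_squares_nat_le) (auto simp: N_def)
  finally show ?thesis by simp
qed

section \<open>From a periodic solution to its coefficient sequence\<close>

locale wright_periodic =
  fixes \<alpha> \<omega> :: real and y :: "real \<Rightarrow> real"
  assumes alpha: "\<alpha> \<noteq> 0" and sol: "wright_solution \<alpha> y" and freq: "has_frequency y \<omega>" and gt: "\<And>t. y t > -1"
begin

abbreviation Y :: "real \<Rightarrow> complex" where "Y \<equiv> \<lambda>t. of_real (y t)"
abbreviation "Y' \<equiv> \<lambda>t. complex_of_real (- \<alpha> * y (t - 1) * (1 + y t))"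
abbreviation "c \<equiv> fcoeff \<omega> Y"

lemma omega: "\<omega> > 0" using freq by (simp add: has_frequency_def)

lemma periodic: "y (t + 2 * pi / \<omega>) = y t"
  using freq periodic_fun_simple.plus_period by (auto simp: has_frequency_def)

lemma deriv_y: "(y has_real_derivative (- \<alpha> * y (t - 1) * (1 + y t))) (at t)"
  using sol by (simp add: wright_solution_def)

lemma deriv_Y: "(Y has_vector_derivative Y' t) (at t)"
  using deriv_y[of t] by (rule has_vector_derivative_of_real)

lemma cont_y: "continuous_on S y"
  using deriv_y DERIV_isCont by (blast intro: continuous_at_imp_continuous_on)

lemma cont_y_delay: "continuous_on S (\<lambda>t. y (t - 1))"
  using continuous_on_compose[of S "\<lambda>t. t - 1" y] cont_y by (simp add: o_def continuous_intros)

lemma cont_Y': "continuous_on S Y'"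
  by (intro continuous_intros cont_y cont_y_delay)

lemma cont_Y: "continuous_on S Y"
  by (intro continuous_intros cont_y)

lemma fcoeff_Y': "fcoeff \<omega> Y' k = \<i> * of_int k * of_real \<omega> * c k"
  using periodic[of 0] by (intro fcoeff_deriv omega deriv_Y cont_Y') simp

text \<open>The L2 norm is a Lebesgue set integral, whereas the Fourier coefficients use the gauge
  integral. By the equation \<open>deriv y\<close> is continuous, so the two integrals agree and the
  default value for non-integrable functions does not occur.\<close>

lemma integral_deriv_le:
  assumes "L2_norm_on {0..2 * pi / \<omega>} (deriv y) \<le> B"
  shows "integral {0..2 * pi / \<omega>} (\<lambda>t. (norm (Y' t))\<^sup>2) \<le> B\<^sup>2"
proof -
  have d: "deriv y = (\<lambda>t. - \<alpha> * y (t - 1) * (1 + y t))"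
    using deriv_y by (auto intro: DERIV_imp_deriv)
  have c: "continuous_on {0..2 * pi / \<omega>} (\<lambda>t. (deriv y t)\<^sup>2)"
    unfolding d by (intro continuous_intros cont_y cont_y_delay)
  have "(LINT t:{0..2 * pi / \<omega>}|lborel. (deriv y t)\<^sup>2) = integral {0..2 * pi / \<omega>} (\<lambda>t. (deriv y t)\<^sup>2)"
    by (rule set_borel_integral_eq_integral(2)[OF borel_integrable_atLeastAtMost'[OF c]])
  also have "\<dots> = integral {0..2 * pi / \<omega>} (\<lambda>t. (norm (Y' t))\<^sup>2)"
    by (simp only: d norm_of_real power2_abs)
  finally have eq: "L2_norm_on {0..2 * pi / \<omega>} (deriv y) = sqrt (integral {0..2 * pi / \<omega>} (\<lambda>t. (norm (Y' t))\<^sup>2))"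
    by (simp add: L2_norm_on_def)
  show ?thesis using assms unfolding eq
    using sqrt_le_D by blast
qed

text \<open>Bessel for \<open>Y'\<close>, whose coefficients carry the factor \<omega> k in modulus;
  dividing by \<omega>^2 leaves \<open>B\<^sup>2 / (2 * pi * \<omega>)\<close>.\<close>

lemma sum_weighted_squares_le:
  assumes "L2_norm_on {0..2 * pi / \<omega>} (deriv y) \<le> B" "finite F"
  shows "(\<Sum>k\<in>F. (of_int k * norm (c k))\<^sup>2) \<le> B\<^sup>2 / (2 * pi * \<omega>)"
proof -
  have "\<omega>\<^sup>2 * (\<Sum>k\<in>F. (of_int k * norm (c k))\<^sup>2) = (\<Sum>k\<in>F. (norm (fcoeff \<omega> Y' k))\<^sup>2)"
    unfolding fcoeff_Y' by (simp add: sum_distrib_left norm_mult power_mult_distrib mult_ac)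
  also have "\<dots> \<le> \<omega> / (2 * pi) * integral {0..2 * pi / \<omega>} (\<lambda>t. (norm (Y' t))\<^sup>2)"
    by (intro bessel_inequality omega cont_Y' assms(2))
  also have "\<dots> \<le> \<omega> / (2 * pi) * B\<^sup>2"
    using omega by (intro mult_left_mono integral_deriv_le assms(1)) auto
  finally show ?thesis using omega by (simp add: field_simps power2_eq_square)
qed

lemma c_0_unshifted: "integral {0..2 * pi / \<omega>} (\<lambda>t. y (t - 1)) = 0"
proof -
  have "((\<lambda>t. - \<alpha> * y (t - 1)) has_integral (ln (1 + y (2 * pi / \<omega>)) - ln (1 + y 0))) {0..2 * pi / \<omega>}"
  proof (rule fundamental_theorem_of_calculus)
    show "0 \<le> 2 * pi / \<omega>" using omega by simp
    fix t
    have "1 + y t > 0" using gt[of t] by simp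
    then have "((\<lambda>t. ln (1 + y t)) has_real_derivative - \<alpha> * y (t - 1)) (at t)"
      by (auto intro!: derivative_eq_intros deriv_y simp: field_simps)
    then show "((\<lambda>t. ln (1 + y t)) has_vector_derivative - \<alpha> * y (t - 1)) (at t within {0..2 * pi / \<omega>})"
      using has_real_derivative_iff_has_vector_derivative has_vector_derivative_at_within by blast
  qed
  from integral_unique[OF this] have "integral {0..2 * pi / \<omega>} (\<lambda>t. - \<alpha> * y (t - 1)) = 0"
    using periodic[of 0] by (simp only: add_0 diff_self)
  then have "- \<alpha> * integral {0..2 * pi / \<omega>} (\<lambda>t. y (t - 1)) = 0"
    by (simp only: integral_mult_right)
  then show ?thesis using alpha by simp
qed

text \<open>Cauchy-Schwarz against the weights 1/k trades the weighted l2 bound for an l1 bound; the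
  inverse squares over both half lines give pi^2/3.\<close>

lemma sum_norm_le:
  assumes "L2_norm_on {0..2 * pi / \<omega>} (deriv y) \<le> B" "finite F" "0 \<notin> F"
  shows "(\<Sum>k\<in>F. norm (c k)) \<le> sqrt (pi\<^sup>2 / 3 * (B\<^sup>2 / (2 * pi * \<omega>)))"
proof (rule real_le_rsqrt)
  have "(\<Sum>k\<in>F. norm (c k)) = (\<Sum>k\<in>F. (1 / of_int k) * (of_int k * norm (c k)))"
    using assms(3) by (intro sum.cong) auto
  also have "\<dots>\<^sup>2 \<le> (\<Sum>k\<in>F. (1 / of_int k)\<^sup>2) * (\<Sum>k\<in>F. (of_int k * norm (c k))\<^sup>2)"
    by (rule Cauchy_Schwarz_ineq_sum)
  also have "\<dots> \<le> pi\<^sup>2 / 3 * (B\<^sup>2 / (2 * pi * \<omega>))"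
    using sum_inverse_squares_int_le[OF assms(2,3)] sum_weighted_squares_le[OF assms(1,2)]
    by (intro mult_mono) (auto simp: power_divide intro!: sum_nonneg)
  finally show "(\<Sum>k\<in>F. norm (c k))\<^sup>2 \<le> pi\<^sup>2 / 3 * (B\<^sup>2 / (2 * pi * \<omega>))" .
qed

lemma c_summable_on: 
  assumes "L2_norm_on {0..2 * pi / \<omega>} (deriv y) \<le> B" 
  shows "(\<lambda>k. norm (c k)) summable_on UNIV"
proof -
  have "(\<lambda>k. norm (c k)) summable_on (UNIV - {0})"
    by (rule nonneg_bdd_above_summable_on) 
       (auto intro!: bdd_aboveI2 sum_norm_le[OF assms])
  then have "(\<lambda>k. norm (c k)) summable_on (insert 0 (UNIV - {0}))"
    by (subst summable_on_insert_iff)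
  then show ?thesis by (simp add: insert_Diff_if)
qed

lemma Y_series:
  assumes "(\<lambda>k. norm (c k)) summable_on UNIV"
  shows "((\<lambda>k. c k * fmode \<omega> k t) has_sum Y t) UNIV"
  by (rule fourier_inversion[OF omega deriv_Y _ assms]) (simp add: periodic)

lemma wright_coeffs:
  assumes s: "(\<lambda>k. norm (c k)) summable_on UNIV"
  shows "wright_coeffs \<alpha> \<omega> c"
proof -
  \<comment> \<open>The coefficients of the delayed function: a delay by 1 multiplies mode j by a
    unimodular phase, so norms and summability are unchanged.\<close>
  define d where "d = (\<lambda>j. c j * cis (- of_int j * \<omega>))"
  have nd: "norm (d j) = norm (c j)" for j by (simp add: d_def norm_mult)
  have ser: "((\<lambda>j. d j * fmode \<omega> j t) has_sum Y (t - 1)) UNIV" for t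
  proof -
    have "c j * fmode \<omega> j (t - 1) = d j * fmode \<omega> j t" for j
      by (simp add: d_def fmode_def mult.assoc cis_mult algebra_simps)
    then show ?thesis using Y_series[OF s, of "t - 1"] by simp
  qed
  have cYd: "continuous_on UNIV (\<lambda>t. Y (t - 1))" by (intro continuous_intros cont_y_delay)
  have ds: "(\<lambda>j. norm (d j)) summable_on UNIV" using s by (simp add: nd)
  have dcoeff: "fcoeff \<omega> (\<lambda>t. Y (t - 1)) k = d k" for k
    by (rule fcoeff_of_series[OF omega cYd ds ser])
  have Yb: "norm (Y t) \<le> infsum (\<lambda>k. norm (c k)) UNIV" for t
    using norm_infsum_bound[of "\<lambda>k. c k * fmode \<omega> k t" UNIV] s Y_series[OF s, of t]
    by (simp add: norm_mult infsumI)
  have conv: "delay_conv \<omega> c k = fcoeff \<omega> (\<lambda>t. Y t * Y (t - 1)) k" for k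
    using fcoeff_mult_has_sum[OF omega cont_Y cYd Yb ds ser, of k]
    by (simp add: delay_conv_def d_def infsumI)
  have "wright_symbol \<alpha> \<omega> k * c k = - of_real \<alpha> * delay_conv \<omega> c k" for k
  proof -
    have "\<i> * of_int k * of_real \<omega> * c k = fcoeff \<omega> (\<lambda>t. - of_real \<alpha> * (Y (t - 1) + Y t * Y (t - 1))) k"
      unfolding fcoeff_Y'[symmetric] by (simp add: algebra_simps)
    also have "\<dots> = - of_real \<alpha> * (d k + delay_conv \<omega> c k)"
      unfolding fcoeff_cmult conv dcoeff[symmetric]
      by (subst fcoeff_add) (auto intro!: continuous_intros cont_y cont_y_delay)
    finally show ?thesis by (simp add: wright_symbol_def d_def algebra_simps)
  qed
  moreover have "c (- k) = cnj (c k)" for k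
    by (simp add: fcoeff_def integral_cnj cnj_fmode)
  moreover have "c 0 = 0"
  proof -
    \<comment> \<open>At index 0 the phase is 1, so \<open>y\<close> and its delay have the same
      mean; the mean of the delay is the one that the logarithmic derivative yields.\<close>
    have "c 0 = d 0" by (simp add: d_def)
    also have "\<dots> = of_real (\<omega> / (2 * pi)) * integral {0..2 * pi / \<omega>} (\<lambda>t. of_real (y (t - 1)))"
      unfolding dcoeff[symmetric] by (simp add: fcoeff_def)
    also have "integral {0..2 * pi / \<omega>} (\<lambda>t. complex_of_real (y (t - 1))) = of_real (integral {0..2 * pi / \<omega>} (\<lambda>t. y (t - 1)))"
      using integral_linear[OF integrable_continuous_real[OF cont_y_delay] bounded_linear_of_real[where ?'a=complex]] by (simp add: o_def)
    finally show ?thesis by (simp add: c_0_unshifted)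
  qed
  ultimately show ?thesis using s by (simp add: wright_coeffs_def)
qed

end

section \<open>Convolutions of absolutely summable sequences\<close>

text \<open>The modes 0, 1, 2 and their negatives are treated one by one; \<open>tail 2\<close> and
  \<open>tail 3\<close> collect what remains beyond the first and beyond the second pair.\<close>

definition tail :: "int \<Rightarrow> (int \<Rightarrow> real) \<Rightarrow> real" where
  "tail n f = (\<Sum>\<^sub>\<infinity>k\<in>{k. n \<le> \<bar>k\<bar>}. f k)"

text \<open>For norms this majorizes \<open>delay_conv\<close>, whose phases are unimodular. Sums of
  nonnegative families can be rearranged and enlarged freely.\<close>

definition conv :: "(int \<Rightarrow> real) \<Rightarrow> (int \<Rightarrow> real) \<Rightarrow> int \<Rightarrow> real" where
  "conv f g k = (\<Sum>\<^sub>\<infinity>j. f j * g (k - j))"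

lemma tail_nonneg: "(\<And>k. 0 \<le> f k) \<Longrightarrow> 0 \<le> tail n f"
  by (simp add: tail_def infsum_nonneg)

lemma summable_on_subset_UNIV: "(f :: int \<Rightarrow> 'a :: banach) summable_on UNIV \<Longrightarrow> f summable_on A"
  by (rule summable_on_subset_banach) auto

lemma tail_Suc:
  assumes "f summable_on UNIV" "0 < n"
  shows "tail n f = f (- n) + f n + tail (n + 1) f"
proof -
  have eq: "{k. n \<le> \<bar>k\<bar>} = {- n, n} \<union> {k. n + 1 \<le> \<bar>k\<bar>}" using assms(2) by auto
  show ?thesis
    unfolding tail_def eq using assms(2)
    by (subst infsum_Un_disjoint) (use summable_on_subset_UNIV[OF assms(1)] in auto)
qed

lemma infsum_eq_tail:
  assumes "f summable_on UNIV"
  shows "infsum f UNIV = f (- 1) + f 0 + f 1 + tail 2 f"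
proof -
  have eq: "UNIV = {- 1, 0, 1} \<union> {k::int. 2 \<le> \<bar>k\<bar>}" by auto
  show ?thesis
    unfolding tail_def 
    by (subst eq, subst infsum_Un_disjoint) (use summable_on_subset_UNIV[OF assms] in auto)
qed

lemma pair_le_tail:
  assumes "f summable_on UNIV" "\<And>k. 0 \<le> f k" "n \<le> \<bar>k\<bar>" "k \<noteq> 0"
  shows "f k + f (- k) \<le> tail n f"
proof -
  have "f k + f (- k) = sum f {k, - k}" using assms(4) by simp
  also have "\<dots> \<le> tail n f"
    unfolding tail_def using assms by (intro finite_sum_le_infsum summable_on_subset_UNIV[OF assms(1)]) auto
  finally show ?thesis .
qed

lemma le_tail:
  assumes "f summable_on UNIV" "\<And>k. 0 \<le> f k" "n \<le> \<bar>k\<bar>"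
  shows "f k \<le> tail n f"
proof -
  have "f k = sum f {k}" by simp
  also have "\<dots> \<le> tail n f"
    unfolding tail_def using assms by (intro finite_sum_le_infsum summable_on_subset_UNIV[OF assms(1)]) auto
  finally show ?thesis .
qed

lemma product_has_sum:
  fixes f g :: "int \<Rightarrow> real"
  assumes "f summable_on UNIV" "g summable_on UNIV" "\<And>k. 0 \<le> f k" "\<And>k. 0 \<le> g k"
  shows "((\<lambda>(j, l). f j * g l) has_sum (infsum f A * infsum g B)) (A \<times> B)"
proof (rule has_sum_SigmaI)
  fix j assume "j \<in> A"
  show "((\<lambda>l. case (j, l) of (j, l) \<Rightarrow> f j * g l) has_sum (f j * infsum g B)) B"
    using has_sum_cmult_right[OF has_sum_infsum[OF summable_on_subset_UNIV[OF assms(2)]]] by simp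
next
  show "((\<lambda>j. f j * infsum g B) has_sum infsum f A * infsum g B) A"
    by (rule has_sum_cmult_left, rule has_sum_infsum, rule summable_on_subset_UNIV, rule assms(1))
next
  show "(\<lambda>(j, l). f j * g l) summable_on A \<times> B"
  proof (rule summable_on_SigmaI)
    fix j
    show "((\<lambda>l. case (j, l) of (j, l) \<Rightarrow> f j * g l) has_sum (f j * infsum g B)) B"
      using has_sum_cmult_right[OF has_sum_infsum[OF summable_on_subset_UNIV[OF assms(2)]]] by simp
  next
    show "(\<lambda>j. f j * infsum g B) summable_on A"
      by (rule summable_on_cmult_left, rule summable_on_subset_UNIV, rule assms(1))
  qed (use assms in auto)
qed

text \<open>The bijection sending \<open>(k, j)\<close> to \<open>(j, k - j)\<close> turns a sum of
  a convolution over \<open>K\<close> into a sum of products over the pairs with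
  \<open>j + l\<close> in \<open>K\<close>. Tail estimates then become inclusions between sets of
  pairs.\<close>

lemma conv_has_sum:
  fixes f g :: "int \<Rightarrow> real"
  assumes "f summable_on UNIV" "g summable_on UNIV" "\<And>k. 0 \<le> f k" "\<And>k. 0 \<le> g k"
  shows "(conv f g has_sum (\<Sum>\<^sub>\<infinity>(j, l)\<in>{(j, l). j + l \<in> K}. f j * g l)) K"
    and "(\<lambda>j. f j * g (k - j)) summable_on UNIV"
proof -
  let ?P = "{(j, l). j + l \<in> K}"
  have s: "(\<lambda>(j, l). f j * g l) summable_on A" for A
    using has_sum_imp_summable[OF product_has_sum[OF assms, of UNIV UNIV]]
    by (rule summable_on_subset_banach) auto
  have bij: "bij_betw (\<lambda>(k, j). (j, k - j)) (K' \<times> UNIV) {(j, l). j + l \<in> K'}" for K' :: "int set"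
    by (rule bij_betwI[where g = "\<lambda>(j, l). (j + l, j)"]) auto
  have "((\<lambda>(k, j). f j * g (k - j)) has_sum (\<Sum>\<^sub>\<infinity>(j, l)\<in>{(j, l). j + l \<in> K'}. f j * g l)) (K' \<times> UNIV)" for K'
    using has_sum_reindex_bij_betw[OF bij, of "\<lambda>(j, l). f j * g l"] has_sum_infsum[OF s]
    by (simp add: case_prod_unfold)
  note h = this
  have "(\<lambda>(k, j). f j * g (k - j)) summable_on UNIV \<times> UNIV" 
    using has_sum_imp_summable[OF h[of UNIV]] .
  from summable_on_SigmaD1[OF this] show sj: "(\<lambda>j. f j * g (k - j)) summable_on UNIV" for k by simp
  show "(conv f g has_sum (\<Sum>\<^sub>\<infinity>(j, l)\<in>?P. f j * g l)) K"
    by (rule has_sum_SigmaD[OF h]) (use has_sum_infsum[OF sj] in \<open>simp add: conv_def\<close>)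
qed

lemma conv_nonneg: "(\<And>k. 0 \<le> f k) \<Longrightarrow> (\<And>k. 0 \<le> g k) \<Longrightarrow> 0 \<le> conv f g k"
  by (simp add: conv_def infsum_nonneg)

text \<open>Two indices of modulus at most 1 have a sum of modulus at most 2, with equality only for
  (1, 1) and (-1, -1). Apart from these pairs, which only the second bound sees, one index always
  has modulus at least 2. For small coefficients this makes the tail from 3 one order smaller than
  the tail from 2.\<close>

lemma conv_tail_le:
  fixes f g :: "int \<Rightarrow> real"
  assumes "f summable_on UNIV" "g summable_on UNIV" "\<And>k. 0 \<le> f k" "\<And>k. 0 \<le> g k"
  shows "tail 3 (conv f g) \<le> tail 2 f * (g (-1) + g 0 + g 1 + tail 2 g) + (f (-1) + f 0 + f 1) * tail 2 g"
    and "tail 2 (conv f g) \<le> tail 2 f * (g (-1) + g 0 + g 1 + tail 2 g) + (f (-1) + f 0 + f 1) * tail 2 g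
       + (f 1 * g 1 + f (-1) * g (-1))"
proof -
  let ?F = "\<lambda>(j, l). f j * g l"
  let ?H = "{k::int. 2 \<le> \<bar>k\<bar>}"
  let ?B1 = "?H \<times> UNIV" and ?B2 = "{-1, 0, 1} \<times> ?H" and ?B3 = "{(1, 1), (-1, -1)} :: (int \<times> int) set"
  have s: "?F summable_on A" for A
    using has_sum_imp_summable[OF product_has_sum[OF assms, of UNIV UNIV]]
    by (rule summable_on_subset_banach) auto
  have b12: "infsum ?F (?B1 \<union> ?B2) = tail 2 f * (g (-1) + g 0 + g 1 + tail 2 g) + (f (-1) + f 0 + f 1) * tail 2 g"
  proof -
    have "infsum ?F (?B1 \<union> ?B2) = infsum ?F ?B1 + infsum ?F ?B2"
      by (intro infsum_Un_disjoint s) auto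
    also have "infsum ?F ?B1 = infsum f ?H * infsum g UNIV"
      by (rule infsumI[OF product_has_sum[OF assms]])
    also have "infsum ?F ?B2 = infsum f {-1, 0, 1} * infsum g ?H"
      by (rule infsumI[OF product_has_sum[OF assms]])
    finally show ?thesis unfolding infsum_eq_tail[OF assms(2)] by (simp add: tail_def)
  qed
  have "tail 3 (conv f g) = infsum ?F {(j, l). j + l \<in> {k. 3 \<le> \<bar>k\<bar>}}"
    unfolding tail_def by (rule infsumI[OF conv_has_sum(1)[OF assms]])
  also have "\<dots> \<le> infsum ?F (?B1 \<union> ?B2)"
    using assms(3,4) by (intro infsum_mono2 s) auto
  finally show "tail 3 (conv f g) \<le> tail 2 f * (g (-1) + g 0 + g 1 + tail 2 g) + (f (-1) + f 0 + f 1) * tail 2 g"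
    unfolding b12 .
  have "tail 2 (conv f g) = infsum ?F {(j, l). j + l \<in> {k. 2 \<le> \<bar>k\<bar>}}"
    unfolding tail_def by (rule infsumI[OF conv_has_sum(1)[OF assms]])
  also have "\<dots> \<le> infsum ?F ((?B1 \<union> ?B2) \<union> ?B3)"
  proof (intro infsum_mono2 s subsetI)
    fix x :: "int \<times> int" assume "x \<in> {(j, l). j + l \<in> {k. 2 \<le> \<bar>k\<bar>}}"
    then obtain j l where x: "x = (j, l)" "2 \<le> \<bar>j + l\<bar>" by auto
    consider "2 \<le> \<bar>j\<bar>" | "2 \<le> \<bar>l\<bar>" | "j = 1" "l = 1" | "j = -1" "l = -1" using x(2) by linarith
    then show "x \<in> ?B1 \<union> ?B2 \<union> ?B3" by cases (auto simp: x(1))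
  qed (use assms(3,4) in auto)
  also have "\<dots> = infsum ?F (?B1 \<union> ?B2) + infsum ?F ?B3"
    by (intro infsum_Un_disjoint s) auto
  finally show "tail 2 (conv f g) \<le> tail 2 f * (g (-1) + g 0 + g 1 + tail 2 g) + (f (-1) + f 0 + f 1) * tail 2 g
       + (f 1 * g 1 + f (-1) * g (-1))"
    unfolding b12 by simp
qed

lemma tail_mono:
  assumes "f summable_on UNIV" "g summable_on UNIV" "\<And>k. n \<le> \<bar>k\<bar> \<Longrightarrow> f k \<le> g k"
  shows "tail n f \<le> tail n g"
  unfolding tail_def
  by (rule infsum_mono[OF summable_on_subset_UNIV[OF assms(1)] summable_on_subset_UNIV[OF assms(2)]]) (use assms(3) in auto)

lemma tail_add: 
  "f summable_on UNIV \<Longrightarrow> g summable_on UNIV \<Longrightarrow> tail n (\<lambda>k. f k + g k) = tail n f + tail n g"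
  unfolding tail_def by (rule infsum_add; rule summable_on_subset_UNIV)

lemma tail_cmult: "tail n (\<lambda>k. a * f k) = a * tail n f"
  unfolding tail_def by (rule infsum_cmult_right')

lemma conv_summable:
  fixes f g :: "int \<Rightarrow> real"
  assumes "f summable_on UNIV" "g summable_on UNIV" "\<And>k. 0 \<le> f k" "\<And>k. 0 \<le> g k"
  shows "conv f g summable_on UNIV"
  using has_sum_imp_summable[OF conv_has_sum(1)[OF assms]] .

text \<open>A single value of \<open>g\<close> at an index of modulus at least \<open>n\<close> is
  at most the whole \<open>tail n g\<close>. This handles the part of a convolution in which both
  indices are large.\<close>

lemma tail_conv_rest:
  fixes f g :: "int \<Rightarrow> real"
  assumes "f summable_on UNIV" "g summable_on UNIV" "\<And>k. 0 \<le> f k" "\<And>k. 0 \<le> g k"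
    and "A \<subseteq> {j. n \<le> \<bar>j\<bar> \<and> n \<le> \<bar>k - j\<bar>}"
  shows "(\<Sum>\<^sub>\<infinity>j\<in>A. f j * g (k - j)) \<le> tail n f * tail n g"
proof -
  have "(\<Sum>\<^sub>\<infinity>j\<in>A. f j * g (k - j)) \<le> (\<Sum>\<^sub>\<infinity>j\<in>{j. n \<le> \<bar>j\<bar>}. f j * tail n g)"
  proof (rule infsum_mono_neutral)
    show "(\<lambda>j. f j * g (k - j)) summable_on A"
      by (rule summable_on_subset_UNIV[OF conv_has_sum(2)[OF assms(1-4)]])
    show "(\<lambda>j. f j * tail n g) summable_on {j. n \<le> \<bar>j\<bar>}"
      by (rule summable_on_cmult_left, rule summable_on_subset_UNIV, rule assms(1))
  qed (use assms in \<open>auto intro!: mult_left_mono le_tail mult_nonneg_nonneg tail_nonneg\<close>)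
  also have "\<dots> = tail n f * tail n g"
    unfolding tail_def by (rule infsum_cmult_left')
  finally show ?thesis .
qed

section \<open>A priori bounds\<close>

text \<open>The chord, of length 2 |sin ((a - b) / 2)|, is not longer than the arc.\<close>

lemma norm_cis_diff_le: "norm (cis a - cis b) \<le> \<bar>a - b\<bar>"
proof -
  define d where "d = (a - b) / 2"
  have d: "2 * d = a - b" by (simp add: d_def)
  have "(cos a - cos b)\<^sup>2 + (sin a - sin b)\<^sup>2 = 2 - 2 * cos (a - b)"
    using sin_cos_squared_add[of a] sin_cos_squared_add[of b]
    by (simp add: cos_diff power2_eq_square algebra_simps)
  also have "\<dots> = 4 * (sin d)\<^sup>2" unfolding d[symmetric] cos_double_sin by simp
  also have "\<dots> = 4 * (sin ((a - b) / 2))\<^sup>2" by (simp add: d_def)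
  finally have "(norm (cis a - cis b))\<^sup>2 = (2 * \<bar>sin ((a - b) / 2)\<bar>)\<^sup>2" by (simp add: cmod_power2 power_mult_distrib)
  then have "norm (cis a - cis b) = 2 * \<bar>sin ((a - b) / 2)\<bar>" by (rule power2_eq_imp_eq) auto
  also have "\<dots> \<le> 2 * \<bar>(a - b) / 2\<bar>" by (intro mult_left_mono abs_sin_x_le_abs_x) auto
  finally show ?thesis by simp
qed

lemma wright_symbol_uminus: "wright_symbol \<alpha> \<omega> (- k) = cnj (wright_symbol \<alpha> \<omega> k)"
  by (simp add: wright_symbol_def cis_cnj)

lemma norm_wright_symbol_ge:
  assumes "0 \<le> \<alpha>" "0 \<le> \<omega>"
  shows "of_int \<bar>k\<bar> * \<omega> - \<alpha> \<le> norm (wright_symbol \<alpha> \<omega> k)"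
proof -
  have "norm (\<i> * complex_of_real (of_int k * \<omega>)) - norm (complex_of_real \<alpha> * cis (- of_int k * \<omega>)) \<le> norm (wright_symbol \<alpha> \<omega> k)"
    unfolding wright_symbol_def by (rule norm_diff_ineq)
  then show ?thesis using assms by (simp add: norm_mult abs_mult del: of_real_mult)
qed

lemma norm_wright_symbol_diff_le:
  assumes "0 \<le> \<alpha>"
  shows "norm (wright_symbol \<alpha> \<omega> k - wright_symbol \<alpha> \<omega>' k) \<le> (1 + \<alpha>) * (\<bar>of_int k\<bar> * \<bar>\<omega> - \<omega>'\<bar>)"
proof -
  have "wright_symbol \<alpha> \<omega> k - wright_symbol \<alpha> \<omega>' k = \<i> * of_real (of_int k * (\<omega> - \<omega>')) + of_real \<alpha> * (cis (- of_int k * \<omega>) - cis (- of_int k * \<omega>'))"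
    by (simp add: wright_symbol_def algebra_simps)
  also have "norm \<dots> \<le> \<bar>of_int k\<bar> * \<bar>\<omega> - \<omega>'\<bar> + \<alpha> * norm (cis (- of_int k * \<omega>) - cis (- of_int k * \<omega>'))"
    using assms by (intro norm_triangle_le add_mono) (simp_all add: norm_mult abs_mult del: of_real_mult)
  also have "\<dots> \<le> \<bar>of_int k\<bar> * \<bar>\<omega> - \<omega>'\<bar> + \<alpha> * \<bar>- of_int k * \<omega> - - of_int k * \<omega>'\<bar>"
    using assms by (intro add_mono mult_left_mono norm_cis_diff_le) auto
  also have "- of_int k * \<omega> - - of_int k * \<omega>' = - (of_int k * (\<omega> - \<omega>'))" by (simp add: algebra_simps)
  finally show ?thesis by (simp only: abs_minus_cancel abs_mult) (simp add: distrib_right)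
qed

lemma delay_conv_abs_summable:
  assumes "(\<lambda>k. norm (c k)) summable_on UNIV"
  shows "(\<lambda>j. norm (c j * cis (- of_int j * \<omega>) * c (k - j))) summable_on UNIV"
  using conv_has_sum(2)[OF assms assms] by (simp add: norm_mult)

lemma norm_delay_conv_le:
  assumes "(\<lambda>k. norm (c k)) summable_on UNIV"
  shows "norm (delay_conv \<omega> c k) \<le> conv (\<lambda>k. norm (c k)) (\<lambda>k. norm (c k)) k"
  unfolding delay_conv_def
  using norm_infsum_bound[OF delay_conv_abs_summable[OF assms, of \<omega> k]] by (simp add: conv_def norm_mult)

lemma delay_conv_split:
  assumes "(\<lambda>k. norm (c k)) summable_on UNIV" "finite F"
  shows "delay_conv \<omega> c k = (\<Sum>j\<in>F. c j * cis (- of_int j * \<omega>) * c (k - j))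
     + (\<Sum>\<^sub>\<infinity>j\<in>-F. c j * cis (- of_int j * \<omega>) * c (k - j))"
proof -
  let ?t = "\<lambda>j. c j * cis (- of_int j * \<omega>) * c (k - j)"
  have s: "?t summable_on A" for A
    by (rule summable_on_subset_UNIV[OF abs_summable_summable[OF delay_conv_abs_summable[OF assms(1)]]])
  have "infsum ?t (F \<union> - F) = infsum ?t F + infsum ?t (- F)"
    by (intro infsum_Un_disjoint s) auto
  then show ?thesis using assms(2) by (simp add: delay_conv_def)
qed

locale small_coeffs =
  fixes \<alpha> \<omega> \<epsilon> :: real and c :: "int \<Rightarrow> complex"
  assumes wc: "wright_coeffs \<alpha> \<omega> c" and c_1: "c 1 = of_real \<epsilon>" and eps_nonneg: "0 \<le> \<epsilon>" and eps_le: "\<epsilon> \<le> (701 / 10000)"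
    and alpha_ge: "pi / 2 \<le> \<alpha>" and alpha_le: "\<alpha> \<le> pi / 2 + (553 / 100000)"
    and omega_near: "\<bar>\<omega> - pi / 2\<bar> \<le> (231 / 2500)"
    and total_le: "(\<Sum>\<^sub>\<infinity>k. norm (c k)) \<le> (9 / 50)"
    and nonzero: "\<exists>k. c k \<noteq> 0"
begin

abbreviation n :: "int \<Rightarrow> real" where "n k \<equiv> norm (c k)"
abbreviation "W \<equiv> tail 2 n"
abbreviation "R \<equiv> tail 3 n"
abbreviation "X \<equiv> tail 3 (\<lambda>k. \<bar>of_int k\<bar> * n k)"

lemma n_summable: "n summable_on UNIV" and c_0 [simp]: "c 0 = 0" and c_uminus: "c (- k) = cnj (c k)"
  and c_eq: "wright_symbol \<alpha> \<omega> k * c k = - of_real \<alpha> * delay_conv \<omega> c k"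
  using wc by (auto simp: wright_coeffs_def)

lemma n_uminus [simp]: "n (- k) = n k"
  by (simp add: c_uminus)

lemma c_m1: "c (- 1) = of_real \<epsilon>" using c_uminus[of 1] c_1 by simp

lemma n_1: "n 1 = \<epsilon>" "n (- 1) = \<epsilon>" 
  using eps_nonneg by (simp_all add: c_1 c_m1 del: n_uminus)

lemma alpha_bounds: "(15707 / 10000) \<le> \<alpha>" "\<alpha> \<le> (157633 / 100000)"
  using alpha_ge alpha_le pi_approx by simp_all

lemma omega_bounds: "(147839 / 100000) \<le> \<omega>" "\<omega> \<le> (2079 / 1250)"
  using omega_near alpha_le pi_approx unfolding abs_le_iff by simp_all

lemma total: "(\<Sum>\<^sub>\<infinity>k. norm (c k)) = 2 * \<epsilon> + W"
  using infsum_eq_tail[OF n_summable] by (simp add: n_1)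

lemma W_nonneg: "0 \<le> W" and R_nonneg: "0 \<le> R" and X_nonneg: "0 \<le> X"
  by (simp_all add: tail_nonneg)

lemma n_2: "2 * n 2 + R = W"
  using tail_Suc[OF n_summable, of 2] by simp

lemma n_3: "2 * n 3 \<le> R" and n_4: "2 * n 4 \<le> R"
  using pair_le_tail[OF n_summable, of 3 3] pair_le_tail[OF n_summable, of 3 4] by simp_all

text \<open>Division by the symbol, cleared of denominators. Taking \<open>a = 1\<close> bounds a
  mode, taking for \<open>a\<close> the modulus of \<open>k\<close> bounds a weighted mode.\<close>

lemma norm_c_le:
  assumes "\<alpha> * a \<le> norm (wright_symbol \<alpha> \<omega> k) * b"  "0 \<le> a" "0 < norm (wright_symbol \<alpha> \<omega> k)"
  shows "a * n k \<le> b * conv n n k"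
proof -
  have "norm (wright_symbol \<alpha> \<omega> k) * n k = \<alpha> * norm (delay_conv \<omega> c k)"
    using arg_cong[OF c_eq[of k], of norm] alpha_bounds by (simp add: norm_mult)
  also have "\<dots> \<le> \<alpha> * conv n n k"
    using alpha_bounds by (intro mult_left_mono norm_delay_conv_le n_summable) auto
  finally have "a * (norm (wright_symbol \<alpha> \<omega> k) * n k) \<le> a * (\<alpha> * conv n n k)"
    using assms(2) by (intro mult_left_mono)
  also have "\<dots> \<le> norm (wright_symbol \<alpha> \<omega> k) * b * conv n n k"
    using mult_right_mono[OF assms(1), of "conv n n k"] by (simp add: conv_nonneg mult_ac)
  finally have "norm (wright_symbol \<alpha> \<omega> k) * (a * n k) \<le> norm (wright_symbol \<alpha> \<omega> k) * (b * conv n n k)"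
    by (simp add: mult_ac)
  then show ?thesis using assms(3) by simp
qed

lemma conv_n: "tail 3 (conv n n) \<le> (4 * \<epsilon> + W) * W" "tail 2 (conv n n) \<le> (4 * \<epsilon> + W) * W + 2 * \<epsilon>\<^sup>2"
  using conv_tail_le[OF n_summable n_summable] 
  by (simp_all add: n_1 algebra_simps power2_eq_square)

lemma conv_n_summable: "conv n n summable_on UNIV"
  by (intro conv_summable n_summable) auto

lemma cos_omega: "cos \<omega> = - sin (\<omega> - pi / 2)"
  by (simp add: sin_diff)

text \<open>The reverse triangle inequality would only give about 1.38 here. Near \<omega> = pi/2,
  however, \<open>cis (- 2 * \<omega>)\<close> is close to -1, so the delay term is almost
  orthogonal to the imaginary term and both contribute. The value 2.857 is what |k| \<ge> 3 allows,
  where 3 \<omega> - \<alpha> is just above it.\<close>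

lemma norm_symbol_2_crude: "(2857 / 1000) \<le> norm (wright_symbol \<alpha> \<omega> 2)"
proof -
  have co: "\<bar>cos \<omega>\<bar> \<le> (231 / 2500)"
    using omega_near abs_sin_x_le_abs_x[of "\<omega> - pi / 2"] unfolding cos_omega by simp
  have "(cos \<omega>)\<^sup>2 \<le> (231 / 2500)\<^sup>2" using power_mono[OF co, of 2] by simp
  then have c2: "cos (2 * \<omega>) \<le> - (491 / 500)" by (simp add: cos_double_cos power2_eq_square)
  have "\<bar>sin (2 * \<omega>)\<bar> = 2 * (\<bar>sin \<omega>\<bar> * \<bar>cos \<omega>\<bar>)" by (simp add: sin_double abs_mult)
  also have "\<dots> \<le> 2 * (1 * (231 / 2500))" using co by (intro mult_left_mono mult_mono) auto
  finally have s2: "sin (2 * \<omega>) \<le> (231 / 1250)" by simp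
  have "\<alpha> * sin (2 * \<omega>) \<le> \<alpha> * (231 / 1250)" using s2 alpha_bounds by (intro mult_left_mono) auto
  also have "\<dots> \<le> 2914 / 10000" using alpha_bounds by simp
  finally have im: "(133 / 50) \<le> Im (wright_symbol \<alpha> \<omega> 2)"
    using alpha_bounds omega_bounds by (simp add: wright_symbol_def)
  have "\<alpha> * cos (2 * \<omega>) \<le> \<alpha> * (- (491 / 500))" using c2 alpha_bounds by (intro mult_left_mono) auto
  also have "\<dots> \<le> - (154 / 100)" using alpha_bounds by simp
  finally have re: "Re (wright_symbol \<alpha> \<omega> 2) \<le> - (77 / 50)"
    using alpha_bounds by (simp add: wright_symbol_def)
  have "(2857 / 1000)\<^sup>2 \<le> ((77 / 50)::real)\<^sup>2 + (133 / 50)\<^sup>2" by (simp add: power2_eq_square)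
  also have "\<dots> \<le> (- Re (wright_symbol \<alpha> \<omega> 2))\<^sup>2 + (Im (wright_symbol \<alpha> \<omega> 2))\<^sup>2"
    using re im by (intro add_mono power_mono) auto
  also have "\<dots> = (norm (wright_symbol \<alpha> \<omega> 2))\<^sup>2" by (simp add: cmod_power2)
  finally show ?thesis by (rule power2_le_imp_le) simp
qed

text \<open>The constant 69/125 bounds \<alpha> / 2.857. The quantity \<open>W\<close> occurs on
  both sides, quadratically on the right.\<close>

lemma W_le_crude: "W \<le> (69 / 125) * ((4 * \<epsilon> + W) * W + 2 * \<epsilon>\<^sup>2)"
proof -
  have "n k \<le> (69 / 125) * conv n n k" if "2 \<le> \<bar>k\<bar>" for k
  proof -
    have sym: "(2857 / 1000) \<le> norm (wright_symbol \<alpha> \<omega> k)"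
    proof (cases "3 \<le> \<bar>k\<bar>")
      case True
      then have "3 * \<omega> \<le> of_int \<bar>k\<bar> * \<omega>" using omega_bounds by (intro mult_right_mono) linarith+
      then show ?thesis using norm_wright_symbol_ge[of \<alpha> \<omega> k] alpha_bounds omega_bounds by linarith
    next
      case False
      then have "k = 2 \<or> k = - 2" using that by linarith
      then show ?thesis using norm_symbol_2_crude wright_symbol_uminus[of \<alpha> \<omega> 2] by auto
    qed
    then have "0 < norm (wright_symbol \<alpha> \<omega> k)" by linarith
    then show ?thesis using sym norm_c_le[of 1 k "(69 / 125)"] alpha_bounds by simp
  qed
  then have "W \<le> tail 2 (\<lambda>k. (69 / 125) * conv n n k)"
    by (intro tail_mono n_summable summable_on_cmult_right conv_n_summable)
  also have "\<dots> \<le> (69 / 125) * ((4 * \<epsilon> + W) * W + 2 * \<epsilon>\<^sup>2)"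
    unfolding tail_cmult using conv_n(2) by (intro mult_left_mono) auto
  finally show ?thesis .
qed

text \<open>The quadratic inequality alone would not exclude large \<open>W\<close>. As 4 \<epsilon>
  + W is at most twice the l1 norm, hence at most 9/25, its product with \<open>W\<close> is
  absorbed on the left, which leaves a constant just below 1.38.\<close>

lemma W_le: "W \<le> (69 / 50) * \<epsilon>\<^sup>2"
proof -
  define A where "A = (4 * \<epsilon> + W) * W"
  have "A \<le> (9 / 25) * W"
    unfolding A_def using total total_le W_nonneg by (intro mult_right_mono) auto
  moreover have "125 * W \<le> 69 * A + 138 * \<epsilon>\<^sup>2" using W_le_crude unfolding A_def by simp
  moreover have "0 \<le> \<epsilon>\<^sup>2" by simp
  ultimately show ?thesis by linarith
qed

lemma eps_pos: "0 < \<epsilon>"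
proof (rule ccontr)
  assume "\<not> 0 < \<epsilon>"
  then have e: "\<epsilon> = 0" using eps_nonneg by simp
  have "W = 0" using W_le W_nonneg e by simp
  then have "n k = 0" for k
  proof (cases "2 \<le> \<bar>k\<bar>")
    case True
    then show ?thesis using le_tail[OF n_summable, of 2 k] \<open>W = 0\<close> by simp
  next
    case False
    then have "k = 0 \<or> k = 1 \<or> k = - 1" by linarith
    then show ?thesis using e by (auto simp: c_1 c_m1 simp del: n_uminus)
  qed
  then show False using nonzero by simp
qed

lemma eps_sq_le: "\<epsilon>\<^sup>2 \<le> (491401 / 100000000)"
  using power_mono[OF eps_le eps_nonneg, of 2] by (simp add: power2_eq_square)

text \<open>The mode \<open>k = 0\<close> of the equation fixes the frequency, since \<open>c 0 = 0\<close>.\<close>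

lemma cos_omega_le: "\<bar>cos \<omega>\<bar> \<le> (117 / 25000)"
proof -
  let ?t = "\<lambda>j. c j * cis (- of_int j * \<omega>) * c (0 - j)"
  let ?F = "{-1, 0, 1} :: int set"
  have "delay_conv \<omega> c 0 = 0" using c_eq[of 0] alpha_bounds by simp
  then have sum0: "(\<Sum>j\<in>?F. ?t j) = - infsum ?t (- ?F)"
    using delay_conv_split[OF n_summable, of ?F \<omega> 0] by (simp only: eq_neg_iff_add_eq_0 finite.intros simp_thms)
  have cs: "cis \<omega> + cis (- \<omega>) = of_real (2 * cos \<omega>)" by (simp add: complex_eq_iff)
  \<comment> \<open>The modes 1 and -1 contribute 2 \<epsilon>^2 cos \<omega>, everything else at
    most W^2 = O(\<epsilon>^4). Cancelling 2 \<epsilon>^2, which is positive by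
    \<open>eps_pos\<close>, leaves cos \<omega> = O(\<epsilon>^2).\<close>
  have "(\<Sum>j\<in>?F. ?t j) = of_real (\<epsilon>\<^sup>2) * (cis \<omega> + cis (- \<omega>))"
    by (simp add: c_1 c_m1 power2_eq_square algebra_simps)
  then have "(\<Sum>j\<in>?F. ?t j) = of_real (2 * \<epsilon>\<^sup>2 * cos \<omega>)" unfolding cs by simp
  then have "norm (complex_of_real (2 * \<epsilon>\<^sup>2 * cos \<omega>)) = norm (infsum ?t (- ?F))"
    by (simp only: sum0 norm_minus_cancel flip: \<open>(\<Sum>j\<in>?F. ?t j) = of_real (2 * \<epsilon>\<^sup>2 * cos \<omega>)\<close>)
  also have "\<dots> \<le> (\<Sum>\<^sub>\<infinity>j\<in>-?F. n j * n (0 - j))"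
    using norm_infsum_bound[OF summable_on_subset_UNIV[OF delay_conv_abs_summable[OF n_summable, of \<omega> 0]], of "- ?F"]
    by (simp add: norm_mult)
  also have "\<dots> \<le> W * W"
    by (intro tail_conv_rest n_summable) auto
  also have "\<dots> \<le> ((69 / 50) * \<epsilon>\<^sup>2) * ((69 / 50) * \<epsilon>\<^sup>2)"
    using W_le W_nonneg by (intro mult_mono) auto
  finally have "2 * \<epsilon>\<^sup>2 * \<bar>cos \<omega>\<bar> \<le> (2 * \<epsilon>\<^sup>2) * ((4761 / 5000) * \<epsilon>\<^sup>2)"
    by (simp add: abs_mult norm_mult norm_power del: of_real_mult)
  then have "\<bar>cos \<omega>\<bar> \<le> (4761 / 5000) * \<epsilon>\<^sup>2"
    by (rule mult_left_le_imp_le) (use eps_pos in simp)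
  then show ?thesis using eps_sq_le by simp
qed

text \<open>In the window |x| \<le> 0.0924 the cubic remainder of the sine is at most 0.0015 |x|, so
  the smallness of sin x = - cos \<omega> passes to x with almost no loss. The window also singles
  out pi/2 among the zeros of the cosine.\<close>

lemma omega_near': "\<bar>\<omega> - pi / 2\<bar> \<le> (47 / 10000)"
proof -
  define x where "x = \<omega> - pi / 2"
  have x: "\<bar>x\<bar> \<le> (231 / 2500)" using omega_near by (simp add: x_def)
  have "\<bar>sin x - x\<bar> \<le> \<bar>x\<bar> ^ 3 / 6"
    using Maclaurin_sin_bound[of x 3] by (simp add: eval_nat_numeral sin_coeff_def)
  also have "\<bar>x\<bar> ^ 3 = \<bar>x\<bar>\<^sup>2 * \<bar>x\<bar>" by (simp add: eval_nat_numeral)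
  also have "\<dots> / 6 \<le> (231 / 2500)\<^sup>2 * \<bar>x\<bar> / 6"
    using x by (intro divide_right_mono mult_right_mono power_mono) auto
  finally have "\<bar>sin x - x\<bar> \<le> (3 / 2000) * \<bar>x\<bar>" by (simp add: power2_eq_square)
  moreover have "\<bar>sin x\<bar> \<le> (117 / 25000)" using cos_omega_le unfolding cos_omega x_def by simp
  ultimately show ?thesis unfolding x_def[symmetric] by linarith
qed

section \<open>The modes |k| \<ge> 3 in the narrowed frequency range\<close>

lemma omega_bounds': "(156609 / 100000) \<le> \<omega>" "\<omega> \<le> (3939 / 2500)"
  using omega_near' pi_approx unfolding abs_le_iff by simp_all

text \<open>The slope 1.0406 lies just below \<omega> - \<alpha>/3, so |k| = 3 is the critical case.
  Growth proportional to |k| is what gains a weight |k| for the modes.\<close>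

lemma symbol_ge:
  assumes "3 \<le> \<bar>k\<bar>"
  shows "(5203 / 5000) * of_int \<bar>k\<bar> \<le> norm (wright_symbol \<alpha> \<omega> k)"
proof -
  have "3 * (\<omega> - (5203 / 5000)) \<le> of_int \<bar>k\<bar> * (\<omega> - (5203 / 5000))"
    using assms omega_bounds' by (intro mult_right_mono) linarith+
  then show ?thesis using norm_wright_symbol_ge[of \<alpha> \<omega> k] alpha_bounds omega_bounds' by (simp add: algebra_simps)
qed

lemma conv_n_3: "tail 3 (conv n n) \<le> (56537 / 10000) * \<epsilon> ^ 3"
proof -
  have "(69 / 50) * \<epsilon>\<^sup>2 \<le> (48369 / 500000) * \<epsilon>"
    using mult_right_mono[OF eps_le eps_nonneg] by (simp add: power2_eq_square)
  then have "(4 * \<epsilon> + W) * W \<le> ((2048369 / 500000) * \<epsilon>) * ((69 / 50) * \<epsilon>\<^sup>2)"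
    using W_le W_nonneg eps_nonneg by (intro mult_mono) auto
  also have "\<dots> \<le> (56537 / 10000) * \<epsilon> ^ 3" using eps_nonneg by (simp add: eval_nat_numeral)
  finally show ?thesis using conv_n(1) by simp
qed

lemma weighted_le:
  assumes "3 \<le> \<bar>k\<bar>"
  shows "\<bar>of_int k\<bar> * n k \<le> (303 / 200) * conv n n k"
proof (rule norm_c_le)
  have "\<alpha> * of_int \<bar>k\<bar> \<le> (1576509 / 1000000) * of_int \<bar>k\<bar>"
    using alpha_bounds by (intro mult_right_mono) auto
  then show "\<alpha> * \<bar>of_int k\<bar> \<le> norm (wright_symbol \<alpha> \<omega> k) * (303 / 200)" using symbol_ge[OF assms] by simp
  show "0 < norm (wright_symbol \<alpha> \<omega> k)" using symbol_ge[OF assms] assms by linarith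
qed simp

text \<open>Bessel only makes the weighted modes square summable. The equation improves this:
  dividing a summable convolution by a symbol of size |k| gains the weight.\<close>

lemma weighted_summable: "(\<lambda>k. \<bar>of_int k\<bar> * n k) summable_on UNIV"
proof -
  have "(\<lambda>k. \<bar>of_int k\<bar> * n k) summable_on {k. 3 \<le> \<bar>k\<bar>}"
  proof (rule summable_on_comparison_test)
    show "(\<lambda>k. (303 / 200) * conv n n k) summable_on {k. 3 \<le> \<bar>k\<bar>}"
      by (intro summable_on_cmult_right summable_on_subset_UNIV[OF conv_n_summable])
    show "\<bar>of_int k\<bar> * n k \<le> (303 / 200) * conv n n k" if "k \<in> {k. 3 \<le> \<bar>k\<bar>}" for k
      using that by (intro weighted_le) simp
  qed simp
  moreover have "(\<lambda>k. \<bar>of_int k\<bar> * n k) summable_on {-2..2}" by simp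
  ultimately have "(\<lambda>k. \<bar>of_int k\<bar> * n k) summable_on ({k. 3 \<le> \<bar>k\<bar>} \<union> {-2..2})"
    by (intro summable_on_Un_disjoint) auto
  also have "{k. 3 \<le> \<bar>k\<bar>} \<union> {-2..2} = (UNIV :: int set)" by auto
  finally show ?thesis .
qed

lemma X_le: "X \<le> (857 / 100) * \<epsilon> ^ 3"
proof -
  have "X \<le> tail 3 (\<lambda>k. (303 / 200) * conv n n k)"
    by (intro tail_mono weighted_summable summable_on_cmult_right conv_n_summable weighted_le)
  then have "X \<le> (303 / 200) * tail 3 (conv n n)" unfolding tail_cmult .
  moreover have "0 \<le> \<epsilon> ^ 3" using eps_nonneg by simp
  ultimately show ?thesis using conv_n_3 by linarith
qed

lemma R_le: "R \<le> (143 / 50) * \<epsilon> ^ 3"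
proof -
  have "3 * R = tail 3 (\<lambda>k. 3 * n k)" by (simp add: tail_cmult)
  also have "\<dots> \<le> X"
    by (intro tail_mono weighted_summable summable_on_cmult_right n_summable mult_right_mono) auto
  finally have "3 * R \<le> X" .
  moreover have "0 \<le> \<epsilon> ^ 3" using eps_nonneg by simp
  ultimately show ?thesis using X_le by linarith
qed

lemma norm_cis_omega_le: "norm (cis (a * \<omega>) - cis (a * (pi / 2))) \<le> \<bar>a\<bar> * (47 / 10000)"
proof -
  have "norm (cis (a * \<omega>) - cis (a * (pi / 2))) \<le> \<bar>a * \<omega> - a * (pi / 2)\<bar>" by (rule norm_cis_diff_le)
  also have "\<dots> = \<bar>a\<bar> * \<bar>\<omega> - pi / 2\<bar>" by (simp only: abs_mult flip: right_diff_distrib)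
  also have "\<dots> \<le> \<bar>a\<bar> * (47 / 10000)" using omega_near' by (rule mult_left_mono) simp
  finally show ?thesis .
qed

text \<open>The reference value is the symbol at \<alpha> = \<omega> = pi/2. The deviation splits
  into the errors of the linear term, of \<alpha> and of the phase, about 0.0094 + 0.0055 +
  0.0148.\<close>

lemma symbol_2_near: "norm (wright_symbol \<alpha> \<omega> 2 - Complex (- (pi / 2)) pi) \<le> (3 / 100)"
proof -
  have cpi: "cis (- 2 * (pi / 2)) = - 1" using cis_pi by (simp add: complex_eq_iff)
  have eq: "wright_symbol \<alpha> \<omega> 2 - Complex (- (pi / 2)) pi =
     \<i> * of_real (2 * (\<omega> - pi / 2)) + of_real (\<alpha> - pi / 2) * cis (- 2 * \<omega>) + of_real (pi / 2) * (cis (- 2 * \<omega>) - cis (- 2 * (pi / 2)))"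
    unfolding cpi by (simp add: wright_symbol_def complex_eq_iff algebra_simps)
  have "norm (wright_symbol \<alpha> \<omega> 2 - Complex (- (pi / 2)) pi) \<le> 2 * (47 / 10000) + (553 / 100000) + (3927 / 2500) * (2 * (47 / 10000))"
    unfolding eq
  proof (intro norm_triangle_mono)
    show "norm (\<i> * complex_of_real (2 * (\<omega> - pi / 2))) \<le> 2 * (47 / 10000)"
      using omega_near' by (simp only: norm_mult norm_ii norm_of_real abs_mult abs_numeral mult_1_left mult_le_cancel_left_pos zero_less_numeral)
    show "norm (complex_of_real (\<alpha> - pi / 2) * cis (- 2 * \<omega>)) \<le> (553 / 100000)"
      unfolding norm_mult norm_of_real using alpha_ge alpha_le by simp
    show "norm (complex_of_real (pi / 2) * (cis (- 2 * \<omega>) - cis (- 2 * (pi / 2)))) \<le> (3927 / 2500) * (2 * (47 / 10000))"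
      unfolding norm_mult norm_of_real using norm_cis_omega_le[of "- 2"] pi_approx
      by (intro mult_mono) auto
  qed
  then show ?thesis by simp
qed

text \<open>The reference value has modulus sqrt 5 pi / 2, about 3.512, and the symbol is within
  0.03 of it.\<close>

lemma symbol_2_bounds: "(87 / 25) \<le> norm (wright_symbol \<alpha> \<omega> 2)" "norm (wright_symbol \<alpha> \<omega> 2) \<le> (71 / 20)"
proof -
  let ?z = "Complex (- (pi / 2)) pi"
  have z: "(norm ?z)\<^sup>2 = 5 / 4 * (pi * pi)" by (simp only: cmod_power2 complex.sel) (simp add: power2_eq_square)
  have p: "(6283 / 2000) * (6283 / 2000) \<le> pi * pi" "pi * pi \<le> (3927 / 1250) * (3927 / 1250)"
    using pi_approx by (intro mult_mono; simp)+
  have "(351 / 100)\<^sup>2 \<le> (norm ?z)\<^sup>2" "(norm ?z)\<^sup>2 \<le> (88 / 25)\<^sup>2"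
    unfolding z using p by (simp_all add: power2_eq_square)
  then have "(351 / 100) \<le> norm ?z" "norm ?z \<le> (88 / 25)"
    using power2_le_imp_le[of "(351 / 100)" "norm ?z"] power2_le_imp_le[of "norm ?z" "(88 / 25)"] by simp_all
  then show "(87 / 25) \<le> norm (wright_symbol \<alpha> \<omega> 2)" "norm (wright_symbol \<alpha> \<omega> 2) \<le> (71 / 20)"
    using symbol_2_near norm_triangle_ineq2[of ?z "wright_symbol \<alpha> \<omega> 2"] norm_triangle_ineq2[of "wright_symbol \<alpha> \<omega> 2" ?z]
    by (auto simp: norm_minus_commute)
qed

end

section \<open>Comparison of two solutions\<close>

text \<open>The subtracted products are those of the modes \<open>- 1\<close> and \<open>2\<close>, for real \<open>c 1 = c (- 1)\<close>.\<close>

definition mode1_rest :: "real \<Rightarrow> (int \<Rightarrow> complex) \<Rightarrow> complex" where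
  "mode1_rest \<omega> c = delay_conv \<omega> c 1 - c 1 * (cis \<omega> + cis (- 2 * \<omega>)) * c 2"

text \<open>The order of the amplitudes, a choice of labels, makes \<open>Y\<close> nonnegative and
  lets powers of \<epsilon> bound the modes of both solutions.\<close>

locale small_coeffs_pair =
  A: small_coeffs \<alpha> \<omega> \<epsilon> c + B: small_coeffs \<alpha> \<omega>' \<eta> b
  for \<alpha> \<omega> \<omega>' \<epsilon> \<eta> :: real and c b :: "int \<Rightarrow> complex" +
  assumes eta_le: "\<eta> \<le> \<epsilon>"
begin

abbreviation d :: "int \<Rightarrow> real" where "d k \<equiv> norm (c k - b k)"
abbreviation "D \<equiv> tail 3 d"
abbreviation "P \<equiv> d 2"
definition "\<theta> = \<bar>\<omega> - \<omega>'\<bar>"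
definition "Y = \<epsilon>\<^sup>2 - \<eta>\<^sup>2"
abbreviation wb :: "int \<Rightarrow> real" where "wb k \<equiv> \<bar>of_int k\<bar> * B.n k"

lemma theta_nonneg [simp]: "0 \<le> \<theta>"
  by (simp add: \<theta>_def)

lemma d_summable: "d summable_on UNIV"
  by (rule summable_on_comparison_test[OF summable_on_add[OF A.n_summable B.n_summable]])
     (auto intro: norm_triangle_ineq4)

lemma d_uminus: "d (- k) = d k"
  by (simp add: A.c_uminus B.c_uminus flip: complex_cnj_diff)

lemma d_1: "d 1 = \<epsilon> - \<eta>" and d_m1: "d (- 1) = \<epsilon> - \<eta>"
  using eta_le by (simp_all add: A.c_1 B.c_1 A.c_m1 B.c_m1 flip: of_real_diff)

lemma d_tail_2: "tail 2 d = 2 * P + D"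
  using tail_Suc[OF d_summable, of 2] d_uminus[of 2] by simp

lemma d_3: "2 * d 3 \<le> D" and d_4: "2 * d 4 \<le> D"
  using pair_le_tail[OF d_summable, of 3 3] pair_le_tail[OF d_summable, of 3 4] d_uminus[of 3] d_uminus[of 4]
  by simp_all

lemma D_nonneg: "0 \<le> D"
  by (simp add: tail_nonneg)

text \<open>The two coefficients are exchanged one at a time and the phase last, so the frequency
  difference multiplies only coefficients of \<open>b\<close>. The weight in \<open>wb\<close> is
  the Lipschitz constant of the phase of mode j in the frequency.\<close>

definition bound_term :: "int \<Rightarrow> int \<Rightarrow> real" where
  "bound_term k j = d j * A.n (k - j) + B.n j * d (k - j) + \<theta> * (wb j * B.n (k - j))"

lemma term_diff_le:
  "norm (c j * cis (- of_int j * \<omega>) * c (k - j) - b j * cis (- of_int j * \<omega>') * b (k - j)) \<le> bound_term k j"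
proof -
  let ?e = "cis (- of_int j * \<omega>)" and ?e' = "cis (- of_int j * \<omega>')"
  have e: "norm (?e - ?e') \<le> \<bar>of_int j\<bar> * \<theta>"
  proof -
    have "norm (?e - ?e') \<le> \<bar>- of_int j * \<omega> - - of_int j * \<omega>'\<bar>" by (rule norm_cis_diff_le)
    also have "- of_int j * \<omega> - - of_int j * \<omega>' = - (of_int j * (\<omega> - \<omega>'))" by (simp add: algebra_simps)
    finally show ?thesis by (simp add: abs_mult \<theta>_def)
  qed
  have eq: "c j * ?e * c (k - j) - b j * ?e' * b (k - j) =
      (c j - b j) * ?e * c (k - j) + b j * ?e * (c (k - j) - b (k - j)) + b j * (?e - ?e') * b (k - j)"
    by (simp add: algebra_simps)
  have "norm (c j * ?e * c (k - j) - b j * ?e' * b (k - j)) \<le>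
      norm ((c j - b j) * ?e * c (k - j)) + norm (b j * ?e * (c (k - j) - b (k - j))) + norm (b j * (?e - ?e') * b (k - j))"
    unfolding eq by (rule order_trans[OF norm_triangle_ineq add_right_mono[OF norm_triangle_ineq]])
  moreover have "norm ((c j - b j) * ?e * c (k - j)) = d j * A.n (k - j)"
    "norm (b j * ?e * (c (k - j) - b (k - j))) = B.n j * d (k - j)"
    by (simp_all only: norm_mult norm_cis mult_1_right)
  moreover have "norm (b j * (?e - ?e') * b (k - j)) \<le> \<theta> * (wb j * B.n (k - j))"
    using mult_right_mono[OF e, of "B.n j * B.n (k - j)"] by (simp add: norm_mult mult_ac)
  ultimately show ?thesis unfolding bound_term_def by linarith
qed

lemma parts_summable:
  "(\<lambda>j. d j * A.n (k - j)) summable_on S" "(\<lambda>j. B.n j * d (k - j)) summable_on S"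
  "(\<lambda>j. wb j * B.n (k - j)) summable_on S"
  using summable_on_subset_UNIV[OF conv_has_sum(2)[OF d_summable A.n_summable]]
    summable_on_subset_UNIV[OF conv_has_sum(2)[OF B.n_summable d_summable]]
    summable_on_subset_UNIV[OF conv_has_sum(2)[OF B.weighted_summable B.n_summable]] by simp_all

lemma infsum_diff_le:
  "norm ((\<Sum>\<^sub>\<infinity>j\<in>S. c j * cis (- of_int j * \<omega>) * c (k - j)) - (\<Sum>\<^sub>\<infinity>j\<in>S. b j * cis (- of_int j * \<omega>') * b (k - j)))
    \<le> (\<Sum>\<^sub>\<infinity>j\<in>S. d j * A.n (k - j)) + (\<Sum>\<^sub>\<infinity>j\<in>S. B.n j * d (k - j)) + \<theta> * (\<Sum>\<^sub>\<infinity>j\<in>S. wb j * B.n (k - j))"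
proof -
  let ?t = "\<lambda>j. c j * cis (- of_int j * \<omega>) * c (k - j)" and ?t' = "\<lambda>j. b j * cis (- of_int j * \<omega>') * b (k - j)"
  have s: "?t summable_on S" "?t' summable_on S"
    by (rule summable_on_subset_UNIV, rule abs_summable_summable, rule delay_conv_abs_summable, fact A.n_summable B.n_summable)+
  have sb: "bound_term k summable_on S"
    unfolding bound_term_def[abs_def] by (intro summable_on_add summable_on_cmult_right parts_summable)
  have "infsum ?t S - infsum ?t' S = (\<Sum>\<^sub>\<infinity>j\<in>S. ?t j + - ?t' j)"
    using s by (subst infsum_add) (auto simp: infsum_uminus summable_on_uminus)
  also have "norm \<dots> \<le> infsum (bound_term k) S"
    by (rule norm_infsum_le[OF has_sum_infsum has_sum_infsum])
       (use summable_on_add[OF s(1) summable_on_uminus[THEN iffD2, OF s(2)]] sb term_diff_le in auto)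
  also have "\<dots> = (\<Sum>\<^sub>\<infinity>j\<in>S. d j * A.n (k - j)) + (\<Sum>\<^sub>\<infinity>j\<in>S. B.n j * d (k - j)) + \<theta> * (\<Sum>\<^sub>\<infinity>j\<in>S. wb j * B.n (k - j))"
    unfolding bound_term_def[abs_def]
    by (intro infsumI has_sum_add has_sum_cmult_right has_sum_infsum parts_summable)
  finally show ?thesis .
qed

lemma delay_conv_diff_le:
  "norm (delay_conv \<omega> c k - delay_conv \<omega>' b k) \<le> conv d A.n k + conv B.n d k + \<theta> * conv wb B.n k"
  using infsum_diff_le[of k UNIV] by (simp add: delay_conv_def conv_def)

lemma rest_diff_le:
  assumes "S \<subseteq> {j. 3 \<le> \<bar>j\<bar> \<and> 3 \<le> \<bar>k - j\<bar>}"
  shows "norm ((\<Sum>\<^sub>\<infinity>j\<in>S. c j * cis (- of_int j * \<omega>) * c (k - j)) - (\<Sum>\<^sub>\<infinity>j\<in>S. b j * cis (- of_int j * \<omega>') * b (k - j)))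
    \<le> D * A.R + B.R * D + \<theta> * (B.X * B.R)"
proof -
  have "(\<Sum>\<^sub>\<infinity>j\<in>S. d j * A.n (k - j)) \<le> D * A.R" "(\<Sum>\<^sub>\<infinity>j\<in>S. B.n j * d (k - j)) \<le> B.R * D"
    "(\<Sum>\<^sub>\<infinity>j\<in>S. wb j * B.n (k - j)) \<le> B.X * B.R"
    by (rule tail_conv_rest[OF _ _ _ _ assms]; simp add: d_summable A.n_summable B.n_summable B.weighted_summable)+
  then have "(\<Sum>\<^sub>\<infinity>j\<in>S. d j * A.n (k - j)) + (\<Sum>\<^sub>\<infinity>j\<in>S. B.n j * d (k - j)) + \<theta> * (\<Sum>\<^sub>\<infinity>j\<in>S. wb j * B.n (k - j))
      \<le> D * A.R + B.R * D + \<theta> * (B.X * B.R)"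
    by (intro add_mono mult_left_mono) auto
  with infsum_diff_le show ?thesis by (rule order_trans)
qed

text \<open>The symbol of the first solution is kept in front of the difference, so that the change
  of the symbol falls on \<open>b k\<close>, which is known to be small for |k| \<ge> 2.\<close>

lemma symbol_diff_eq:
  "wright_symbol \<alpha> \<omega> k * (c k - b k) = - ((wright_symbol \<alpha> \<omega> k - wright_symbol \<alpha> \<omega>' k) * b k)
     - of_real \<alpha> * (delay_conv \<omega> c k - delay_conv \<omega>' b k)"
  using A.c_eq[of k] B.c_eq[of k] by (simp add: algebra_simps)

lemma norm_symbol_diff_le:
  "norm (wright_symbol \<alpha> \<omega> k) * d k \<le> (1 + \<alpha>) * (\<bar>of_int k\<bar> * \<theta>) * B.n k
     + \<alpha> * norm (delay_conv \<omega> c k - delay_conv \<omega>' b k)"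
proof -
  have "norm (wright_symbol \<alpha> \<omega> k) * d k = norm (wright_symbol \<alpha> \<omega> k * (c k - b k))" by (simp add: norm_mult)
  also have "\<dots> \<le> norm (wright_symbol \<alpha> \<omega> k - wright_symbol \<alpha> \<omega>' k) * B.n k
     + \<alpha> * norm (delay_conv \<omega> c k - delay_conv \<omega>' b k)"
    unfolding symbol_diff_eq using A.alpha_bounds
    by (intro order_trans[OF norm_triangle_ineq4] add_mono) (simp_all add: norm_mult)
  also have "\<dots> \<le> (1 + \<alpha>) * (\<bar>of_int k\<bar> * \<theta>) * B.n k + \<alpha> * norm (delay_conv \<omega> c k - delay_conv \<omega>' b k)"
    unfolding \<theta>_def using A.alpha_bounds by (intro add_right_mono mult_right_mono norm_wright_symbol_diff_le) auto
  finally show ?thesis .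
qed

text \<open>The symbol and its change both grow like |k|, so \<open>B.n k\<close> enters without a
  weight. The constants 2.48 and 0.505 bound (1 + \<alpha>) / 1.0406 and \<alpha> / (3 *
  1.0406).\<close>

lemma d_le:
  assumes k: "3 \<le> \<bar>k\<bar>"
  shows "d k \<le> (62 / 25) * \<theta> * B.n k + (101 / 200) * (conv d A.n k + conv B.n d k + \<theta> * conv wb B.n k)"
proof -
  define L where "L = norm (wright_symbol \<alpha> \<omega> k)"
  define M where "M = conv d A.n k + conv B.n d k + \<theta> * conv wb B.n k"
  have M: "0 \<le> M" unfolding M_def by (intro add_nonneg_nonneg mult_nonneg_nonneg conv_nonneg) auto
  have k3: "3 \<le> real_of_int \<bar>k\<bar>" using k by linarith
  have L1: "(5203 / 5000) * \<bar>of_int k\<bar> \<le> L" using A.symbol_ge[OF k] by (simp add: L_def)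
  then have L2: "(15609 / 5000) \<le> L" using k3 by simp
  have "L * d k \<le> (1 + \<alpha>) * (\<bar>of_int k\<bar> * \<theta>) * B.n k + \<alpha> * norm (delay_conv \<omega> c k - delay_conv \<omega>' b k)"
    unfolding L_def by (rule norm_symbol_diff_le)
  also have "\<dots> \<le> ((62 / 25) * L) * \<theta> * B.n k + ((101 / 200) * L) * M"
  proof (intro add_mono)
    have "(1 + \<alpha>) * \<bar>of_int k\<bar> \<le> (257633 / 100000) * \<bar>of_int k\<bar>" using A.alpha_bounds by (intro mult_right_mono) auto
    also have "\<dots> \<le> (62 / 25) * L" using L1 by simp
    finally have "(1 + \<alpha>) * \<bar>of_int k\<bar> * (\<theta> * B.n k) \<le> ((62 / 25) * L) * (\<theta> * B.n k)"
      by (intro mult_right_mono) auto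
    then show "(1 + \<alpha>) * (\<bar>of_int k\<bar> * \<theta>) * B.n k \<le> ((62 / 25) * L) * \<theta> * B.n k" by (simp only: mult.assoc)
    have "norm (delay_conv \<omega> c k - delay_conv \<omega>' b k) \<le> M" unfolding M_def by (rule delay_conv_diff_le)
    then show "\<alpha> * norm (delay_conv \<omega> c k - delay_conv \<omega>' b k) \<le> ((101 / 200) * L) * M"
      using A.alpha_bounds L2 M by (intro mult_mono) auto
  qed
  also have "\<dots> = L * ((62 / 25) * \<theta> * B.n k + (101 / 200) * M)" by (simp add: algebra_simps)
  finally show ?thesis using L2 unfolding M_def[symmetric] by (simp add: mult_le_cancel_left)
qed

section \<open>Bounds in powers of the larger amplitude, and the difference of the modes |k| \<ge>
  3\<close>

lemma eps_cubed_le: "\<epsilon> ^ 3 \<le> (701 / 10000) * \<epsilon>\<^sup>2" "\<epsilon> ^ 3 \<le> (2153 / 6250000)"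
proof -
  show 1: "\<epsilon> ^ 3 \<le> (701 / 10000) * \<epsilon>\<^sup>2"
    using mult_right_mono[OF A.eps_le, of "\<epsilon>\<^sup>2"] by (simp add: eval_nat_numeral mult.assoc)
  with A.eps_sq_le show "\<epsilon> ^ 3 \<le> (2153 / 6250000)" by simp
qed

lemma eta_power_le: "\<eta> ^ m \<le> \<epsilon> ^ m"
  using eta_le B.eps_nonneg by (rule power_mono)

lemma Y_nonneg: "0 \<le> Y"
  using eta_power_le[of 2] by (simp add: Y_def)

text \<open>Since \<open>Y\<close> is the product of \<epsilon> + \<eta> and \<epsilon> - \<eta>, an
  accompanying factor \<epsilon> turns the linear difference of the amplitudes into a multiple of
  \<open>Y\<close>.\<close>

lemma eps_Delta_le: "\<epsilon> * (\<epsilon> - \<eta>) \<le> Y"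
proof -
  have "Y = \<epsilon> * (\<epsilon> - \<eta>) + \<eta> * (\<epsilon> - \<eta>)" by (simp add: Y_def power2_eq_square algebra_simps)
  moreover have "0 \<le> \<eta> * (\<epsilon> - \<eta>)" using eta_le B.eps_nonneg by simp
  ultimately show ?thesis by linarith
qed

lemma W_bounds: "A.W \<le> (69 / 50) * \<epsilon>\<^sup>2" "B.W \<le> (69 / 50) * \<epsilon>\<^sup>2" "A.W \<le> (3391 / 500000)" "B.W \<le> (3391 / 500000)"
  using A.W_le B.W_le eta_power_le[of 2] A.eps_sq_le by auto

lemma R_bounds: "A.R \<le> (143 / 50) * \<epsilon> ^ 3" "B.R \<le> (143 / 50) * \<epsilon> ^ 3" "A.R \<le> (493 / 500000)" "B.R \<le> (493 / 500000)"
  using A.R_le B.R_le eta_power_le[of 3] eps_cubed_le by auto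

lemma X_bounds: "B.X \<le> (857 / 100) * \<epsilon> ^ 3" "B.X \<le> (2953 / 1000000)"
  using B.X_le eta_power_le[of 3] eps_cubed_le by auto

lemma n_2_bounds: "A.n 2 \<le> (69 / 100) * \<epsilon>\<^sup>2" "B.n 2 \<le> (69 / 100) * \<epsilon>\<^sup>2" "A.n 2 \<le> (3391 / 1000000)" "B.n 2 \<le> (3391 / 1000000)"
  using W_bounds A.n_2 B.n_2 A.R_nonneg B.R_nonneg by auto

text \<open>One factor of \<epsilon>^2 is spent on \<open>eps_Delta_le\<close>, the other is bounded
  by 0.0701.\<close>

lemma Delta_mult_le:
  assumes "x \<le> a * \<epsilon>\<^sup>2" "0 \<le> a" "0 \<le> x"
  shows "(\<epsilon> - \<eta>) * x \<le> (701 / 10000) * a * Y"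
proof -
  have "(\<epsilon> - \<eta>) * x \<le> (\<epsilon> - \<eta>) * (a * \<epsilon>\<^sup>2)" using assms eta_le by (intro mult_left_mono) auto
  also have "\<dots> = (\<epsilon> * a) * (\<epsilon> * (\<epsilon> - \<eta>))" by (simp add: power2_eq_square)
  also have "\<dots> \<le> ((701 / 10000) * a) * Y"
    using A.eps_le A.eps_nonneg assms eta_le eps_Delta_le by (intro mult_mono mult_right_mono) auto
  finally show ?thesis .
qed

lemma D_le: "D \<le> (23 / 100) * Y + (7 / 20) * P + (1 / 200) * \<theta>"
proof -
  have cs: "conv d A.n summable_on UNIV" "conv B.n d summable_on UNIV" "conv wb B.n summable_on UNIV"
    by (intro conv_summable d_summable A.n_summable B.n_summable B.weighted_summable; simp)+
  have "D \<le> tail 3 (\<lambda>k. (62 / 25) * \<theta> * B.n k + (101 / 200) * (conv d A.n k + conv B.n d k + \<theta> * conv wb B.n k))"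
    by (intro tail_mono d_summable summable_on_add summable_on_cmult_right cs B.n_summable d_le)
  also have "\<dots> = (62 / 25) * \<theta> * B.R + (101 / 200) * (tail 3 (conv d A.n) + tail 3 (conv B.n d) + \<theta> * tail 3 (conv wb B.n))"
    by (simp only: tail_add tail_cmult summable_on_add summable_on_cmult_right cs B.n_summable)
  finally have D: "D \<le> (62 / 25) * (\<theta> * B.R) + (101 / 200) * (tail 3 (conv d A.n) + tail 3 (conv B.n d) + \<theta> * tail 3 (conv wb B.n))"
    by (simp add: mult.assoc)
  have R: "\<theta> * B.R \<le> \<theta> * (493 / 500000)" using R_bounds by (intro mult_left_mono) auto
  have DW: "(\<epsilon> - \<eta>) * A.W \<le> (121 / 1250) * Y" "(\<epsilon> - \<eta>) * B.W \<le> (121 / 1250) * Y"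
    using Delta_mult_le[OF W_bounds(1) _ A.W_nonneg] Delta_mult_le[OF W_bounds(2) _ B.W_nonneg] Y_nonneg by auto
  have c1: "tail 3 (conv d A.n) \<le> tail 2 d * (2 * \<epsilon> + A.W) + 2 * ((\<epsilon> - \<eta>) * A.W)"
    using conv_tail_le(1)[OF d_summable A.n_summable] by (simp add: d_1 d_m1 A.n_1 algebra_simps)
  have c2: "tail 3 (conv B.n d) \<le> 2 * ((\<epsilon> - \<eta>) * B.W) + tail 2 d * (B.W + 2 * \<eta>)"
    using conv_tail_le(1)[OF B.n_summable d_summable] by (simp add: d_1 d_m1 B.n_1 algebra_simps)
  \<comment> \<open>The l1 norms of both solutions together stay below 0.294. As
    \<open>tail 2 d = 2 * P + D\<close>, this factor is small enough for \<open>D\<close> to be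
    absorbed on the left at the end.\<close>
  have g: "tail 2 d * (2 * \<epsilon> + A.W) + tail 2 d * (B.W + 2 * \<eta>) \<le> tail 2 d * (147 / 500)"
    unfolding distrib_left[symmetric] using W_bounds A.eps_le B.eps_le by (intro mult_left_mono tail_nonneg) auto
  have "tail 2 wb = 4 * B.n 2 + B.X"
    using tail_Suc[OF B.weighted_summable, of 2] by simp
  then have wb: "tail 2 wb \<le> (16517 / 1000000)" using n_2_bounds X_bounds by simp
  have "tail 3 (conv wb B.n) \<le> tail 2 wb * (2 * \<eta> + B.W) + (2 * \<eta>) * B.W"
    using conv_tail_le(1)[OF B.weighted_summable B.n_summable] by (simp add: B.n_1 algebra_simps)
  also have "\<dots> \<le> (16517 / 1000000) * (147 / 1000) + (701 / 5000) * (3391 / 500000)"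
    using wb W_bounds B.eps_le B.eps_nonneg B.W_nonneg by (intro add_mono mult_mono) auto
  also have "\<dots> \<le> (17 / 5000)" by simp
  finally have "\<theta> * tail 3 (conv wb B.n) \<le> \<theta> * (17 / 5000)" by (intro mult_left_mono) auto
  with DW c1 c2 g have "tail 3 (conv d A.n) + tail 3 (conv B.n d) + \<theta> * tail 3 (conv wb B.n)
      \<le> (242 / 625) * Y + tail 2 d * (147 / 500) + \<theta> * (17 / 5000)"
    by linarith
  moreover define T where "T = tail 3 (conv d A.n) + tail 3 (conv B.n d) + \<theta> * tail 3 (conv wb B.n)"
  ultimately have "T \<le> (242 / 625) * Y + (147 / 250) * P + (147 / 500) * D + (17 / 5000) * \<theta>" by (simp add: d_tail_2 algebra_simps)
  moreover have "D \<le> (62 / 25) * (\<theta> * B.R) + (101 / 200) * T" using D by (simp add: T_def)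
  ultimately show ?thesis using R Y_nonneg theta_nonneg norm_ge_zero[of "c 2 - b 2"] unfolding d_tail_2 by linarith
qed

section \<open>The equations for k = 2 and k = 1\<close>

lemma mode2_rest:
  "norm ((delay_conv \<omega> c 2 - of_real (\<epsilon>\<^sup>2) * cis (- \<omega>)) - (delay_conv \<omega>' b 2 - of_real (\<eta>\<^sup>2) * cis (- \<omega>')))
     \<le> bound_term 2 (- 2) + bound_term 2 (- 1) + bound_term 2 3 + bound_term 2 4 + (D * A.R + B.R * D + \<theta> * (B.X * B.R))"
proof -
  \<comment> \<open>Outside \<open>?F\<close> both indices have modulus at least 3. Inside, 0 and 2
    drop out because \<open>c 0 = 0\<close>, 1 is the subtracted leading term, and the rest are the
    pairs -1, 3 and -2, 4.\<close>
  let ?F = "{- 2, - 1, 0, 1, 2, 3, 4} :: int set"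
  let ?t = "\<lambda>j. c j * cis (- of_int j * \<omega>) * c (2 - j)" and ?t' = "\<lambda>j. b j * cis (- of_int j * \<omega>') * b (2 - j)"
  have "delay_conv \<omega> c 2 = (\<Sum>j\<in>?F. ?t j) + infsum ?t (- ?F)"
    by (rule delay_conv_split[OF A.n_summable]) simp
  also have "(\<Sum>j\<in>?F. ?t j) = ?t (-2) + ?t (-1) + of_real (\<epsilon>\<^sup>2) * cis (- \<omega>) + ?t 3 + ?t 4"
    by (simp add: A.c_1 power2_eq_square)
  finally have A: "delay_conv \<omega> c 2 = ?t (-2) + ?t (-1) + of_real (\<epsilon>\<^sup>2) * cis (- \<omega>) + ?t 3 + ?t 4 + infsum ?t (- ?F)" .
  have "delay_conv \<omega>' b 2 = (\<Sum>j\<in>?F. ?t' j) + infsum ?t' (- ?F)"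
    by (rule delay_conv_split[OF B.n_summable]) simp
  also have "(\<Sum>j\<in>?F. ?t' j) = ?t' (-2) + ?t' (-1) + of_real (\<eta>\<^sup>2) * cis (- \<omega>') + ?t' 3 + ?t' 4"
    by (simp add: B.c_1 power2_eq_square)
  finally have B: "delay_conv \<omega>' b 2 = ?t' (-2) + ?t' (-1) + of_real (\<eta>\<^sup>2) * cis (- \<omega>') + ?t' 3 + ?t' 4 + infsum ?t' (- ?F)" .
  have eq: "(delay_conv \<omega> c 2 - of_real (\<epsilon>\<^sup>2) * cis (- \<omega>)) - (delay_conv \<omega>' b 2 - of_real (\<eta>\<^sup>2) * cis (- \<omega>'))
     = (?t (-2) - ?t' (-2)) + (?t (-1) - ?t' (-1)) + (?t 3 - ?t' 3) + (?t 4 - ?t' 4) + (infsum ?t (- ?F) - infsum ?t' (- ?F))"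
    unfolding A B by (simp only: algebra_simps)
  have "- ?F \<subseteq> {j. 3 \<le> \<bar>j\<bar> \<and> 3 \<le> \<bar>2 - j\<bar>}" by auto
  then show ?thesis
    unfolding eq by (intro norm_triangle_mono term_diff_le rest_diff_le)
qed

text \<open>The second bound, on a single solution, serves the later division of the two rests by
  different amplitudes.\<close>

lemma mode1_rest_le:
  "norm (mode1_rest \<omega> c - mode1_rest \<omega>' b) \<le> bound_term 1 (- 2) + bound_term 1 3 + (D * A.R + B.R * D + \<theta> * (B.X * B.R))"
  "norm (mode1_rest \<omega>' b) \<le> B.R * B.W"
proof -
  \<comment> \<open>Here 0 and 1 drop out, -1 and 2 form the product removed in
    \<open>mode1_rest\<close>, and -2 and 3 couple the second mode with the third.\<close>
  let ?F = "{- 2, - 1, 0, 1, 2, 3} :: int set"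
  let ?t = "\<lambda>j. c j * cis (- of_int j * \<omega>) * c (1 - j)" and ?t' = "\<lambda>j. b j * cis (- of_int j * \<omega>') * b (1 - j)"
  have "delay_conv \<omega> c 1 = (\<Sum>j\<in>?F. ?t j) + infsum ?t (- ?F)"
    by (rule delay_conv_split[OF A.n_summable]) simp
  also have "(\<Sum>j\<in>?F. ?t j) = ?t (-2) + c 1 * (cis \<omega> + cis (- 2 * \<omega>)) * c 2 + ?t 3"
    by (simp add: A.c_1 A.c_m1 algebra_simps)
  finally have A: "mode1_rest \<omega> c = ?t (-2) + ?t 3 + infsum ?t (- ?F)" by (simp add: mode1_rest_def)
  have "delay_conv \<omega>' b 1 = (\<Sum>j\<in>?F. ?t' j) + infsum ?t' (- ?F)"
    by (rule delay_conv_split[OF B.n_summable]) simp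
  also have "(\<Sum>j\<in>?F. ?t' j) = ?t' (-2) + b 1 * (cis \<omega>' + cis (- 2 * \<omega>')) * b 2 + ?t' 3"
    by (simp add: B.c_1 B.c_m1 algebra_simps)
  finally have B: "mode1_rest \<omega>' b = ?t' (-2) + ?t' 3 + infsum ?t' (- ?F)" by (simp add: mode1_rest_def)
  have F: "- ?F \<subseteq> {j. 3 \<le> \<bar>j\<bar> \<and> 3 \<le> \<bar>1 - j\<bar>}" by auto
  have eq: "mode1_rest \<omega> c - mode1_rest \<omega>' b = (?t (-2) - ?t' (-2)) + (?t 3 - ?t' 3) + (infsum ?t (- ?F) - infsum ?t' (- ?F))"
    unfolding A B by (simp only: algebra_simps)
  show "norm (mode1_rest \<omega> c - mode1_rest \<omega>' b) \<le> bound_term 1 (- 2) + bound_term 1 3 + (D * A.R + B.R * D + \<theta> * (B.X * B.R))"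
    unfolding eq by (intro norm_triangle_mono term_diff_le rest_diff_le F)
  have "norm (infsum ?t' (- ?F)) \<le> (\<Sum>\<^sub>\<infinity>j\<in>-?F. B.n j * B.n (1 - j))"
    using norm_infsum_bound[OF summable_on_subset_UNIV[OF delay_conv_abs_summable[OF B.n_summable, of \<omega>' 1]], of "- ?F"]
    by (simp add: norm_mult)
  also have "\<dots> \<le> B.R * B.R"
    by (intro tail_conv_rest B.n_summable F) auto
  finally have "norm (mode1_rest \<omega>' b) \<le> norm (?t' (-2)) + norm (?t' 3) + B.R * B.R"
    unfolding B by (intro norm_triangle_mono order_refl)
  also have "\<dots> = B.n 2 * (2 * B.n 3) + B.R * B.R"
    using B.n_uminus[of 2] by (simp add: norm_mult)
  also have "\<dots> \<le> B.n 2 * B.R + B.R * B.R"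
    using B.n_3 by (intro add_right_mono mult_left_mono) auto
  also have "\<dots> = B.R * (B.n 2 + B.R)" by (simp add: algebra_simps)
  also have "\<dots> \<le> B.R * B.W"
    using B.n_2 by (intro mult_left_mono B.R_nonneg) (auto simp flip: B.n_2)
  finally show "norm (mode1_rest \<omega>' b) \<le> B.R * B.W" .
qed

lemma mode2_rest_numeric:
  "bound_term 2 (- 2) + bound_term 2 (- 1) + bound_term 2 3 + bound_term 2 4 + (D * A.R + B.R * D + \<theta> * (B.X * B.R))
     \<le> (141 / 10000) * Y + (151 / 2000) * D + (1 / 1000) * P + (1 / 5000) * \<theta>"
proof -
  have n3: "A.n 3 \<le> A.R / 2" "B.n 3 \<le> B.R / 2" "A.n 4 \<le> A.R / 2" "B.n 4 \<le> B.R / 2" "d 3 \<le> D / 2" "d 4 \<le> D / 2"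
    using A.n_3 B.n_3 A.n_4 B.n_4 d_3 d_4 by auto
  have n3': "A.n 3 \<le> (493 / 1000000)" "B.n 3 \<le> (493 / 1000000)" "A.n 4 \<le> (493 / 1000000)" "B.n 4 \<le> (493 / 1000000)"
    using n3 R_bounds by auto
  have "A.n 3 \<le> (100243 / 1000000) * \<epsilon>\<^sup>2" "B.n 3 \<le> (100243 / 1000000) * \<epsilon>\<^sup>2"
    using n3 R_bounds eps_cubed_le by auto
  then have Dn: "(\<epsilon> - \<eta>) * A.n 3 \<le> (703 / 100000) * Y" "(\<epsilon> - \<eta>) * B.n 3 \<le> (703 / 100000) * Y"
    using Delta_mult_le[of "A.n 3" "(100243 / 1000000)"] Delta_mult_le[of "B.n 3" "(100243 / 1000000)"] Y_nonneg by auto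
  have e1: "\<eta> * d 3 \<le> (701 / 10000) * (D / 2)" "\<epsilon> * d 3 \<le> (701 / 10000) * (D / 2)"
    using n3 A.eps_le B.eps_le by (intro mult_mono; simp)+
  have e2: "\<eta> * B.n 3 \<le> (701 / 10000) * (493 / 1000000)"
    using n3' B.eps_le by (intro mult_mono; simp)
  have e3: "P * A.n 4 \<le> P * (493 / 1000000)" "P * B.n 4 \<le> P * (493 / 1000000)"
    using n3' by (intro mult_left_mono; simp)+
  have e4: "A.n 2 * d 4 \<le> (3391 / 1000000) * (D / 2)" "B.n 2 * d 4 \<le> (3391 / 1000000) * (D / 2)"
    using n3 n_2_bounds by (intro mult_mono; simp)+
  have e5: "B.n 2 * B.n 4 \<le> (3391 / 1000000) * (493 / 1000000)"
    using n3' n_2_bounds by (intro mult_mono; simp)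
  have e6: "D * A.R \<le> D * (493 / 500000)" "D * B.R \<le> D * (493 / 500000)"
    using R_bounds D_nonneg by (intro mult_left_mono; simp)+
  have e7: "B.X * B.R \<le> (2953 / 1000000) * (493 / 500000)"
    using X_bounds R_bounds B.R_nonneg by (intro mult_mono) auto
  \<comment> \<open>The weights 4 = 1 + 3 and 6 = 2 + 4 add the moduli of the two indices in each
    pair.\<close>
  have "4 * (\<eta> * B.n 3) + 6 * (B.n 2 * B.n 4) + B.X * B.R \<le> (1 / 5000)"
    using e2 e5 e7 by simp
  from mult_left_mono[OF this theta_nonneg]
  have th: "\<theta> * (4 * (\<eta> * B.n 3) + 6 * (B.n 2 * B.n 4) + B.X * B.R) \<le> \<theta> * (1 / 5000)" .
  have "bound_term 2 (- 2) + bound_term 2 (- 1) + bound_term 2 3 + bound_term 2 4 + (D * A.R + B.R * D + \<theta> * (B.X * B.R))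
      = ((\<epsilon> - \<eta>) * A.n 3 + (\<epsilon> - \<eta>) * B.n 3) + (\<eta> * d 3 + \<epsilon> * d 3) + (P * A.n 4 + P * B.n 4)
        + (A.n 2 * d 4 + B.n 2 * d 4) + (D * A.R + D * B.R)
        + \<theta> * (4 * (\<eta> * B.n 3) + 6 * (B.n 2 * B.n 4) + B.X * B.R)"
    using A.n_uminus[of 2] B.n_uminus[of 2] d_uminus[of 2] 
    by (simp add: bound_term_def d_m1 A.n_1 B.n_1 del: A.n_uminus B.n_uminus) (simp add: algebra_simps)
  also have "\<dots> \<le> ((703 / 100000) * Y + (703 / 100000) * Y) + ((701 / 10000) * (D / 2) + (701 / 10000) * (D / 2)) + (P * (493 / 1000000) + P * (493 / 1000000))
        + ((3391 / 1000000) * (D / 2) + (3391 / 1000000) * (D / 2)) + (D * (493 / 500000) + D * (493 / 500000)) + \<theta> * (1 / 5000)"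
    by (intro add_mono Dn e1 e3 e4 e6 th)
  also have "\<dots> \<le> (141 / 10000) * Y + (151 / 2000) * D + (1 / 1000) * P + (1 / 5000) * \<theta>"
    using Y_nonneg D_nonneg norm_ge_zero[of "c 2 - b 2"] by linarith
  finally show ?thesis .
qed

text \<open>The remainder \<open>E\<close> of mode 2 and the differences \<open>P\<close> and
  \<open>D\<close> bound one another with coefficients below 1/2, so the linear system can be solved
  for multiples of \<open>Y\<close> and \<theta>. Its main source is Y cis (- \<omega>), from the
  square of the first mode.\<close>

lemma P_D_le: "P \<le> (237 / 500) * Y + (1 / 125) * \<theta>" "D \<le> (99 / 250) * Y + (1 / 125) * \<theta>"
  and mode2_rest_le:
  "norm ((delay_conv \<omega> c 2 - of_real (\<epsilon>\<^sup>2) * cis (- \<omega>)) - (delay_conv \<omega>' b 2 - of_real (\<eta>\<^sup>2) * cis (- \<omega>')))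
     \<le> (447 / 10000) * Y + (1 / 1000) * \<theta>"
proof -
  define E where "E = norm ((delay_conv \<omega> c 2 - of_real (\<epsilon>\<^sup>2) * cis (- \<omega>)) - (delay_conv \<omega>' b 2 - of_real (\<eta>\<^sup>2) * cis (- \<omega>')))"
  have E: "E \<le> (141 / 10000) * Y + (151 / 2000) * D + (1 / 1000) * P + (1 / 5000) * \<theta>"
    unfolding E_def using mode2_rest mode2_rest_numeric by linarith
  have "delay_conv \<omega> c 2 - delay_conv \<omega>' b 2 =
      ((delay_conv \<omega> c 2 - of_real (\<epsilon>\<^sup>2) * cis (- \<omega>)) - (delay_conv \<omega>' b 2 - of_real (\<eta>\<^sup>2) * cis (- \<omega>')))
      + of_real Y * cis (- \<omega>) + of_real (\<eta>\<^sup>2) * (cis (- \<omega>) - cis (- \<omega>'))"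
    by (simp add: Y_def algebra_simps)
  also have "norm \<dots> \<le> E + Y + \<eta>\<^sup>2 * \<theta>"
  proof (intro norm_triangle_mono)
    show "norm (complex_of_real (\<eta>\<^sup>2) * (cis (- \<omega>) - cis (- \<omega>'))) \<le> \<eta>\<^sup>2 * \<theta>"
      using norm_cis_diff_le[of "- \<omega>" "- \<omega>'"] by (simp add: norm_mult norm_power mult_left_mono \<theta>_def abs_minus_commute)
  qed (use Y_nonneg in \<open>simp_all add: E_def norm_mult del: of_real_diff of_real_power\<close>)
  also have "\<eta>\<^sup>2 * \<theta> \<le> (491401 / 100000000) * \<theta>" using B.eps_sq_le by (intro mult_right_mono) auto
  finally have N: "norm (delay_conv \<omega> c 2 - delay_conv \<omega>' b 2) \<le> E + Y + (491401 / 100000000) * \<theta>" by simp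
  have b2: "(1 + \<alpha>) * (2 * \<theta>) * B.n 2 \<le> (257633 / 100000) * (2 * \<theta>) * (3391 / 1000000)"
    using A.alpha_bounds n_2_bounds by (intro mult_mono) auto
  have "(87 / 25) * P \<le> norm (wright_symbol \<alpha> \<omega> 2) * P"
    using A.symbol_2_bounds by (intro mult_right_mono) auto
  also have "\<dots> \<le> (1 + \<alpha>) * (2 * \<theta>) * B.n 2 + \<alpha> * norm (delay_conv \<omega> c 2 - delay_conv \<omega>' b 2)"
    using norm_symbol_diff_le[of 2] by simp
  also have "\<dots> \<le> (257633 / 100000) * (2 * \<theta>) * (3391 / 1000000) + (157633 / 100000) * (E + Y + (491401 / 100000000) * \<theta>)"
    using N A.alpha_bounds by (intro add_mono[OF b2 mult_mono]) auto
  finally have P: "(87 / 25) * P \<le> (157633 / 100000) * E + (157633 / 100000) * Y + (1261 / 50000) * \<theta>" using theta_nonneg by argo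
  show "P \<le> (237 / 500) * Y + (1 / 125) * \<theta>" "D \<le> (99 / 250) * Y + (1 / 125) * \<theta>" 
    using E P D_le Y_nonneg D_nonneg theta_nonneg by linarith+
  then show "norm ((delay_conv \<omega> c 2 - of_real (\<epsilon>\<^sup>2) * cis (- \<omega>)) - (delay_conv \<omega>' b 2 - of_real (\<eta>\<^sup>2) * cis (- \<omega>')))
     \<le> (447 / 10000) * Y + (1 / 1000) * \<theta>"
    using E Y_nonneg theta_nonneg unfolding E_def by linarith
qed

text \<open>In each product one factor is bounded by a multiple of \<epsilon> rather than by a
  number, so that a factor \<epsilon> remains to cancel the division by the amplitude.\<close>

lemma mode1_rest_numeric:
  "bound_term 1 (- 2) + bound_term 1 3 + (D * A.R + B.R * D + \<theta> * (B.X * B.R)) \<le> \<epsilon> * ((37 / 1000) * Y + (1 / 1000) * \<theta>)"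
proof -
  have e: "0 \<le> \<epsilon>" by (rule A.eps_nonneg)
  have r: "\<epsilon>\<^sup>2 \<le> (701 / 10000) * \<epsilon>" using mult_right_mono[OF A.eps_le e] by (simp add: power2_eq_square)
  have r3: "\<epsilon> ^ 3 \<le> (491401 / 100000000) * \<epsilon>" using mult_right_mono[OF A.eps_sq_le e] by (simp add: eval_nat_numeral)
  have n3: "A.n 3 \<le> (703 / 100000) * \<epsilon>" "B.n 3 \<le> (703 / 100000) * \<epsilon>" 
    using A.n_3 B.n_3 R_bounds r3 e by auto
  have R: "A.R \<le> (703 / 50000) * \<epsilon>" "B.R \<le> (703 / 50000) * \<epsilon>" using R_bounds r3 e by auto
  have n2: "A.n 2 \<le> (4837 / 100000) * \<epsilon>" "B.n 2 \<le> (4837 / 100000) * \<epsilon>" using n_2_bounds r e by auto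
  have d3: "d 3 \<le> D / 2" using d_3 by simp
  have e1: "P * A.n 3 \<le> P * ((703 / 100000) * \<epsilon>)" "P * B.n 3 \<le> P * ((703 / 100000) * \<epsilon>)"
    using n3 by (intro mult_left_mono; simp)+
  have e2: "A.n 2 * d 3 \<le> ((4837 / 100000) * \<epsilon>) * (D / 2)" "B.n 2 * d 3 \<le> ((4837 / 100000) * \<epsilon>) * (D / 2)"
    using n2 d3 e by (intro mult_mono; simp)+
  have e3: "D * A.R \<le> D * ((703 / 50000) * \<epsilon>)" "D * B.R \<le> D * ((703 / 50000) * \<epsilon>)"
    using R D_nonneg by (intro mult_left_mono; simp)+
  have e4: "B.n 2 * B.n 3 \<le> (3391 / 1000000) * ((703 / 100000) * \<epsilon>)"
    using n_2_bounds n3 by (intro mult_mono; simp)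
  have e5: "B.X * B.R \<le> (2953 / 1000000) * ((703 / 50000) * \<epsilon>)"
    using X_bounds R B.R_nonneg by (intro mult_mono) auto
  have "5 * (B.n 2 * B.n 3) + B.X * B.R \<le> (17 / 100000) * \<epsilon>" using e4 e5 e by simp
  from mult_left_mono[OF this theta_nonneg]
  have th: "\<theta> * (5 * (B.n 2 * B.n 3) + B.X * B.R) \<le> \<theta> * ((17 / 100000) * \<epsilon>)" .
  have "bound_term 1 (- 2) + bound_term 1 3 + (D * A.R + B.R * D + \<theta> * (B.X * B.R))
      = (P * A.n 3 + P * B.n 3) + (A.n 2 * d 3 + B.n 2 * d 3) + (D * A.R + D * B.R)
        + \<theta> * (5 * (B.n 2 * B.n 3) + B.X * B.R)"
    using A.n_uminus[of 2] B.n_uminus[of 2] d_uminus[of 2] 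
    by (simp add: bound_term_def del: A.n_uminus B.n_uminus) (simp add: algebra_simps)
  also have "\<dots> \<le> (P * ((703 / 100000) * \<epsilon>) + P * ((703 / 100000) * \<epsilon>)) + (((4837 / 100000) * \<epsilon>) * (D / 2) + ((4837 / 100000) * \<epsilon>) * (D / 2))
       + (D * ((703 / 50000) * \<epsilon>) + D * ((703 / 50000) * \<epsilon>)) + \<theta> * ((17 / 100000) * \<epsilon>)"
    by (intro add_mono e1 e2 e3 th)
  also have "\<dots> = \<epsilon> * ((703 / 50000) * P + (7649 / 100000) * D + (17 / 100000) * \<theta>)" by (simp add: field_simps)
  also have "\<dots> \<le> \<epsilon> * ((37 / 1000) * Y + (1 / 1000) * \<theta>)"
  proof (intro mult_left_mono e)
    show "(703 / 50000) * P + (7649 / 100000) * D + (17 / 100000) * \<theta> \<le> (37 / 1000) * Y + (1 / 1000) * \<theta>"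
      using P_D_le Y_nonneg theta_nonneg by linarith
  qed
  finally show ?thesis .
qed

text \<open>Bringing both quotients over \<epsilon> costs the rest of the second solution times
  (\<epsilon> - \<eta>) / (\<epsilon> \<eta>). That rest is O(\<eta>^5), so even after the division
  a factor \<epsilon> (\<epsilon> - \<eta>) \<le> Y is left, multiplied by \<epsilon>^2.\<close>

lemma mode1_rest_quotient_le:
  "norm (mode1_rest \<omega> c / of_real \<epsilon> - mode1_rest \<omega>' b / of_real \<eta>) \<le> (113 / 2000) * Y + (1 / 1000) * \<theta>"
proof -
  have pos: "0 < \<epsilon>" "0 < \<eta>" by (rule A.eps_pos B.eps_pos)+
  have eq: "mode1_rest \<omega> c / of_real \<epsilon> - mode1_rest \<omega>' b / of_real \<eta> = (mode1_rest \<omega> c - mode1_rest \<omega>' b) / of_real \<epsilon> - mode1_rest \<omega>' b * of_real ((\<epsilon> - \<eta>) / (\<epsilon> * \<eta>))"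
    using pos by (simp add: field_simps)
  have "norm ((mode1_rest \<omega> c - mode1_rest \<omega>' b) / of_real \<epsilon>) \<le> (\<epsilon> * ((37 / 1000) * Y + (1 / 1000) * \<theta>)) / \<epsilon>"
    unfolding norm_divide using order_trans[OF mode1_rest_le(1) mode1_rest_numeric] pos Y_nonneg by (intro frac_le) auto
  then have 1: "norm ((mode1_rest \<omega> c - mode1_rest \<omega>' b) / of_real \<epsilon>) \<le> (37 / 1000) * Y + (1 / 1000) * \<theta>" using pos by simp
  have "norm (mode1_rest \<omega>' b) \<le> ((143 / 50) * \<eta> ^ 3) * ((69 / 50) * \<eta>\<^sup>2)"
    using mode1_rest_le(2) mult_mono[OF B.R_le B.W_le] B.W_nonneg pos by simp
  then have "norm (mode1_rest \<omega>' b) * ((\<epsilon> - \<eta>) / (\<epsilon> * \<eta>)) \<le> ((143 / 50) * \<eta> ^ 3) * ((69 / 50) * \<eta>\<^sup>2) * ((\<epsilon> - \<eta>) / (\<epsilon> * \<eta>))"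
    using pos eta_le by (intro mult_right_mono) auto
  also have "\<dots> = (9867 / 2500) * \<eta> ^ 4 * ((\<epsilon> - \<eta>) / \<epsilon>)"
    using pos by (simp add: eval_nat_numeral)
  also have "\<dots> \<le> (9867 / 2500) * \<epsilon> ^ 4 * ((\<epsilon> - \<eta>) / \<epsilon>)"
    using pos eta_le eta_power_le[of 4] by (intro mult_right_mono) auto
  also have "\<dots> = (9867 / 2500) * \<epsilon>\<^sup>2 * (\<epsilon> * (\<epsilon> - \<eta>))"
    using pos by (simp add: eval_nat_numeral)
  also have "\<dots> \<le> (9867 / 2500) * (491401 / 100000000) * Y"
    using eps_Delta_le A.eps_sq_le pos eta_le by (intro mult_mono) auto
  finally have "norm (mode1_rest \<omega>' b) * ((\<epsilon> - \<eta>) / (\<epsilon> * \<eta>)) \<le> (39 / 2000) * Y"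
    using Y_nonneg by linarith
  moreover have "norm (mode1_rest \<omega>' b * of_real ((\<epsilon> - \<eta>) / (\<epsilon> * \<eta>))) = norm (mode1_rest \<omega>' b) * ((\<epsilon> - \<eta>) / (\<epsilon> * \<eta>))"
    using pos eta_le by (simp only: norm_mult norm_of_real abs_of_nonneg divide_nonneg_pos mult_pos_pos diff_ge_0_iff_ge)
  ultimately have 2: "norm (mode1_rest \<omega>' b * of_real ((\<epsilon> - \<eta>) / (\<epsilon> * \<eta>))) \<le> (39 / 2000) * Y" by simp
  show ?thesis
    unfolding eq using norm_triangle_ineq4[of "(mode1_rest \<omega> c - mode1_rest \<omega>' b) / of_real \<epsilon>" "mode1_rest \<omega>' b * of_real ((\<epsilon> - \<eta>) / (\<epsilon> * \<eta>))"] 1 2 by linarith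
qed

text \<open>The equation for \<open>k = 1\<close> divided by the amplitude. Its left side depends on
  the solution only through the frequency, which is how the frequency difference enters.\<close>

lemma symbol_1_eq:
  "wright_symbol \<alpha> \<omega> 1 = - of_real \<alpha> * ((cis \<omega> + cis (- 2 * \<omega>)) * c 2 + mode1_rest \<omega> c / of_real \<epsilon>)"
  "wright_symbol \<alpha> \<omega>' 1 = - of_real \<alpha> * ((cis \<omega>' + cis (- 2 * \<omega>')) * b 2 + mode1_rest \<omega>' b / of_real \<eta>)"
  using A.c_eq[of 1] B.c_eq[of 1] A.eps_pos B.eps_pos
  by (simp_all add: mode1_rest_def A.c_1 B.c_1 field_simps)

text \<open>At \<omega> = pi/2 the sum of the phases is i - 1, of modulus sqrt 2; the deviation adds
  at most 3 * 0.0047.\<close>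

lemma g_bounds:
  "norm (cis \<omega> + cis (- 2 * \<omega>)) \<le> (143 / 100)"
  "norm ((cis \<omega> + cis (- 2 * \<omega>)) - (cis \<omega>' + cis (- 2 * \<omega>'))) \<le> 3 * \<theta>"
proof -
  have c: "cis (1 * (pi / 2)) = \<i>" "cis (- 2 * (pi / 2)) = - 1" by (simp_all add: complex_eq_iff)
  have "(norm (\<i> - 1))\<^sup>2 = 2" unfolding cmod_power2 by simp
  also have "\<dots> \<le> (283 / 200)\<^sup>2" by (simp add: power2_eq_square)
  finally have "norm (\<i> - 1) \<le> (283 / 200)" by (rule power2_le_imp_le) simp
  moreover have "norm ((cis (1 * \<omega>) - cis (1 * (pi / 2))) + (cis (- 2 * \<omega>) - cis (- 2 * (pi / 2))) + (\<i> - 1)) \<le> \<bar>1\<bar> * (47 / 10000) + \<bar>- 2\<bar> * (47 / 10000) + norm (\<i> - 1)"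
    by (intro norm_triangle_mono A.norm_cis_omega_le order_refl)
  ultimately show "norm (cis \<omega> + cis (- 2 * \<omega>)) \<le> (143 / 100)" unfolding c by simp
  have "(cis \<omega> + cis (- 2 * \<omega>)) - (cis \<omega>' + cis (- 2 * \<omega>')) = (cis \<omega> - cis \<omega>') + (cis (- 2 * \<omega>) - cis (- 2 * \<omega>'))" by simp
  also have "norm \<dots> \<le> \<bar>\<omega> - \<omega>'\<bar> + \<bar>- 2 * \<omega> - - 2 * \<omega>'\<bar>"
    by (intro norm_triangle_mono norm_cis_diff_le)
  also have "\<dots> = 3 * \<theta>" by (simp add: \<theta>_def abs_if)
  finally show "norm ((cis \<omega> + cis (- 2 * \<omega>)) - (cis \<omega>' + cis (- 2 * \<omega>'))) \<le> 3 * \<theta>" .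
qed

text \<open>Multiplying by the symbol at \<open>k = 2\<close> lets the equation for that mode
  replace \<open>c 2 - b 2\<close> without a division. The \<alpha>^2 Y term is split off; changes
  of symbols and phases, multiplied by \<open>b 2\<close> or \<eta>^2, and the two remainders form
  the error.\<close>

lemma main_difference:
  "norm (wright_symbol \<alpha> \<omega> 2 * (wright_symbol \<alpha> \<omega> 1 - wright_symbol \<alpha> \<omega>' 1)
      - of_real (\<alpha>\<^sup>2 * Y) * ((cis \<omega> + cis (- 2 * \<omega>)) * cis (- \<omega>))) \<le> (477 / 1000) * Y + (621 / 5000) * \<theta>"
proof -
  define L where "L = wright_symbol \<alpha> \<omega> 2"
  define dL where "dL = L - wright_symbol \<alpha> \<omega>' 2"
  define g where "g = cis \<omega> + cis (- 2 * \<omega>)"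
  define dg where "dg = g - (cis \<omega>' + cis (- 2 * \<omega>'))"
  define h where "h = mode1_rest \<omega> c / of_real \<epsilon> - mode1_rest \<omega>' b / of_real \<eta>"
  define r where "r = (delay_conv \<omega> c 2 - of_real (\<epsilon>\<^sup>2) * cis (- \<omega>)) - (delay_conv \<omega>' b 2 - of_real (\<eta>\<^sup>2) * cis (- \<omega>'))"
  define a where "a = complex_of_real \<alpha>"
  have "L * (c 2 - b 2) = - (dL * b 2) - a * (delay_conv \<omega> c 2 - delay_conv \<omega>' b 2)"
    unfolding L_def dL_def a_def by (rule symbol_diff_eq)
  also have "delay_conv \<omega> c 2 - delay_conv \<omega>' b 2 = r + of_real Y * cis (- \<omega>) + of_real (\<eta>\<^sup>2) * (cis (- \<omega>) - cis (- \<omega>'))"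
    by (simp add: r_def Y_def algebra_simps)
  finally have Ld: "L * (c 2 - b 2) = - (dL * b 2) - a * (r + of_real Y * cis (- \<omega>) + of_real (\<eta>\<^sup>2) * (cis (- \<omega>) - cis (- \<omega>')))" .
  have dw: "wright_symbol \<alpha> \<omega> 1 - wright_symbol \<alpha> \<omega>' 1 = - a * (g * (c 2 - b 2) + dg * b 2 + h)"
    unfolding symbol_1_eq by (simp add: g_def dg_def h_def a_def algebra_simps)
  have "L * (wright_symbol \<alpha> \<omega> 1 - wright_symbol \<alpha> \<omega>' 1) = - a * (g * (L * (c 2 - b 2)) + L * (dg * b 2 + h))"
    unfolding dw by (simp add: algebra_simps)
  then have eq: "L * (wright_symbol \<alpha> \<omega> 1 - wright_symbol \<alpha> \<omega>' 1) - of_real (\<alpha>\<^sup>2 * Y) * (g * cis (- \<omega>))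
      = a * g * dL * b 2 + a * a * g * (r + of_real (\<eta>\<^sup>2) * (cis (- \<omega>) - cis (- \<omega>'))) + (- a) * L * (dg * b 2 + h)"
    unfolding Ld by (simp add: a_def power2_eq_square algebra_simps)
  have "norm (L * (wright_symbol \<alpha> \<omega> 1 - wright_symbol \<alpha> \<omega>' 1) - of_real (\<alpha>\<^sup>2 * Y) * (g * cis (- \<omega>))) \<le> (157633 / 100000) * (143 / 100) * ((257633 / 50000) * \<theta>) * (3391 / 1000000)
      + (157633 / 100000) * (157633 / 100000) * (143 / 100) * (((447 / 10000) * Y + (1 / 1000) * \<theta>) + (491401 / 100000000) * \<theta>)
      + (157633 / 100000) * (71 / 20) * ((3 * \<theta>) * (3391 / 1000000) + ((113 / 2000) * Y + (1 / 1000) * \<theta>))"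
  proof -
    have na: "norm a \<le> (157633 / 100000)" using A.alpha_bounds by (simp add: a_def)
    have ng: "norm g \<le> (143 / 100)" unfolding g_def by (rule g_bounds)
    have nL: "norm L \<le> (71 / 20)" unfolding L_def by (rule A.symbol_2_bounds)
    have nb: "B.n 2 \<le> (3391 / 1000000)" by (rule n_2_bounds)
    have ndg: "norm dg \<le> 3 * \<theta>" unfolding dg_def g_def by (rule g_bounds)
    have nh: "norm h \<le> (113 / 2000) * Y + (1 / 1000) * \<theta>" unfolding h_def by (rule mode1_rest_quotient_le)
    have nr: "norm r \<le> (447 / 10000) * Y + (1 / 1000) * \<theta>" unfolding r_def by (rule mode2_rest_le)
    have "norm dL \<le> (1 + \<alpha>) * (\<bar>of_int 2\<bar> * \<theta>)"
      unfolding dL_def L_def \<theta>_def using A.alpha_bounds by (intro norm_wright_symbol_diff_le) simp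
    also have "\<dots> \<le> (257633 / 100000) * (\<bar>of_int 2\<bar> * \<theta>)" using A.alpha_bounds by (intro mult_right_mono) auto
    finally have ndL: "norm dL \<le> (257633 / 50000) * \<theta>" by simp
    have nc: "norm (complex_of_real (\<eta>\<^sup>2) * (cis (- \<omega>) - cis (- \<omega>'))) \<le> (491401 / 100000000) * \<theta>"
      unfolding norm_mult \<theta>_def norm_of_real abs_power2
      using B.eps_sq_le norm_cis_diff_le[of "- \<omega>" "- \<omega>'"] by (intro mult_mono) auto
    have t1: "norm (a * g * dL * b 2) \<le> (157633 / 100000) * (143 / 100) * ((257633 / 50000) * \<theta>) * (3391 / 1000000)"
      unfolding norm_mult by (intro mult_mono mult_nonneg_nonneg na ng ndL nb norm_ge_zero theta_nonneg) simp_all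
    have t2: "norm (a * a * g * (r + of_real (\<eta>\<^sup>2) * (cis (- \<omega>) - cis (- \<omega>')))) \<le>
        (157633 / 100000) * (157633 / 100000) * (143 / 100) * (((447 / 10000) * Y + (1 / 1000) * \<theta>) + (491401 / 100000000) * \<theta>)"
      unfolding norm_mult[of _ "_ + _"] norm_mult[of _ g] norm_mult[of a]
      by (intro mult_mono mult_nonneg_nonneg na ng norm_triangle_mono nr nc norm_ge_zero) simp_all
    have t3: "norm ((- a) * L * (dg * b 2 + h)) \<le> (157633 / 100000) * (71 / 20) * ((3 * \<theta>) * (3391 / 1000000) + ((113 / 2000) * Y + (1 / 1000) * \<theta>))"
    proof -
      have "norm (dg * b 2) \<le> (3 * \<theta>) * (3391 / 1000000)"
        unfolding norm_mult by (intro mult_mono ndg nb) simp_all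
      then show ?thesis
        unfolding norm_mult[of _ "_ + _"] norm_mult[of _ L] norm_minus_cancel
        by (intro mult_mono mult_nonneg_nonneg na nL norm_triangle_mono nh norm_ge_zero) simp_all
    qed
    show ?thesis unfolding eq by (intro norm_triangle_mono t1 t2 t3)
  qed
  also have "\<dots> \<le> (477 / 1000) * Y + (621 / 5000) * \<theta>"
    using Y_nonneg theta_nonneg by argo
  finally show ?thesis by (simp only: L_def g_def)
qed

text \<open>The number - pi/2 + i is the derivative in \<omega> of the symbol for
  \<open>k = 1\<close> at \<alpha> = \<omega> = pi/2.\<close>

lemma symbol_1_diff:
  "norm ((wright_symbol \<alpha> \<omega> 1 - wright_symbol \<alpha> \<omega>' 1) - of_real (\<omega> - \<omega>') * Complex (- (pi / 2)) 1) \<le> (41 / 2000) * \<theta>"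
proof -
  define S where "S = cball (pi / 2) ((47 / 10000)::real)"
  have S: "convex S" "\<omega> \<in> S" "\<omega>' \<in> S"
    using A.omega_near' B.omega_near' by (auto simp: S_def dist_real_def abs_minus_commute)
  have cs: "\<bar>1 - sin x\<bar> \<le> (47 / 10000)" "\<bar>cos x\<bar> \<le> (47 / 10000)" if "x \<in> S" for x
  proof -
    have "\<bar>x - pi / 2\<bar> \<le> (47 / 10000)" using that by (simp add: S_def dist_real_def abs_minus_commute)
    then have "norm (cis x - cis (pi / 2)) \<le> (47 / 10000)" using norm_cis_diff_le order_trans by blast
    then show "\<bar>1 - sin x\<bar> \<le> (47 / 10000)" "\<bar>cos x\<bar> \<le> (47 / 10000)"
      using abs_Im_le_cmod[of "cis x - cis (pi / 2)"] abs_Re_le_cmod[of "cis x - cis (pi / 2)"] by auto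
  qed
  have re: "norm ((cos \<omega> + \<omega>) - (cos \<omega>' + \<omega>')) \<le> (47 / 10000) * norm (\<omega> - \<omega>')"
    by (rule field_differentiable_bound[OF S(1), where f' = "\<lambda>x. - sin x + 1"])
       (use S cs in \<open>auto intro!: derivative_eq_intros simp: abs_minus_commute\<close>)
  have im: "norm (sin \<omega> - sin \<omega>') \<le> (47 / 10000) * norm (\<omega> - \<omega>')"
    by (rule field_differentiable_bound[OF S(1), where f' = cos])
       (use S cs in \<open>auto intro!: derivative_eq_intros\<close>)
  \<comment> \<open>Adding \<omega> to cos \<omega> cancels the linear part of the cosine at pi/2:
    the components of \<open>z\<close> come from functions with derivatives 1 - sin and - cos, both
    at most 0.0047 in modulus on \<open>S\<close>.\<close>
  define z where "z = Complex ((cos \<omega> + \<omega>) - (cos \<omega>' + \<omega>')) (- (sin \<omega> - sin \<omega>'))"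
  have z: "norm z \<le> (47 / 5000) * \<theta>"
    using cmod_le[of z] re im abs_minus_commute[of "sin \<omega>'" "sin \<omega>"] by (simp add: z_def \<theta>_def)
  have eq: "(wright_symbol \<alpha> \<omega> 1 - wright_symbol \<alpha> \<omega>' 1) - of_real (\<omega> - \<omega>') * Complex (- (pi / 2)) 1
      = of_real \<alpha> * z + of_real (- (\<alpha> - pi / 2) * (\<omega> - \<omega>'))"
    by (simp add: complex_eq_iff wright_symbol_def z_def field_simps)
  have "norm \<dots> \<le> (157633 / 100000) * ((47 / 5000) * \<theta>) + (553 / 100000) * \<theta>"
  proof (intro norm_triangle_mono)
    show "norm (of_real \<alpha> * z) \<le> (157633 / 100000) * ((47 / 5000) * \<theta>)"
      unfolding norm_mult using A.alpha_bounds z by (intro mult_mono) auto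
    have "\<bar>- (\<alpha> - pi / 2)\<bar> * \<theta> \<le> (553 / 100000) * \<theta>"
      using A.alpha_ge A.alpha_le by (intro mult_right_mono) auto
    then show "norm (complex_of_real (- (\<alpha> - pi / 2) * (\<omega> - \<omega>'))) \<le> (553 / 100000) * \<theta>"
      by (simp only: norm_of_real abs_mult \<theta>_def)
  qed
  then show ?thesis unfolding eq using theta_nonneg by linarith
qed

lemma approx_product:
  "norm (wright_symbol \<alpha> \<omega> 2 * (wright_symbol \<alpha> \<omega> 1 - wright_symbol \<alpha> \<omega>' 1)
      - of_real (\<omega> - \<omega>') * (Complex (- (pi / 2)) pi * Complex (- (pi / 2)) 1)) \<le> (13 / 100) * \<theta>"
proof -
  let ?L = "wright_symbol \<alpha> \<omega> 2" and ?d = "wright_symbol \<alpha> \<omega> 1 - wright_symbol \<alpha> \<omega>' 1"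
  let ?V = "Complex (- (pi / 2)) pi" and ?v = "Complex (- (pi / 2)) 1"
  have "?L * ?d - of_real (\<omega> - \<omega>') * (?V * ?v) = ?L * (?d - of_real (\<omega> - \<omega>') * ?v) + (?L - ?V) * (of_real (\<omega> - \<omega>') * ?v)"
    by (simp add: algebra_simps)
  also have "norm \<dots> \<le> (71 / 20) * ((41 / 2000) * \<theta>) + (3 / 100) * (\<theta> * (187 / 100))"
  proof (intro norm_triangle_mono)
    show "norm (?L * (?d - of_real (\<omega> - \<omega>') * ?v)) \<le> (71 / 20) * ((41 / 2000) * \<theta>)"
      unfolding norm_mult by (intro mult_mono A.symbol_2_bounds symbol_1_diff norm_ge_zero) simp
    have "(norm ?v)\<^sup>2 = 1 + pi * pi / 4" by (simp only: cmod_power2 complex.sel) (simp add: power2_eq_square)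
    also have "\<dots> \<le> (187 / 100)\<^sup>2"
      using mult_mono[of pi "(3927 / 1250)" pi "(3927 / 1250)"] pi_approx by (simp add: power2_eq_square)
    finally have v: "norm ?v \<le> (187 / 100)" by (rule power2_le_imp_le) simp
    have "norm (complex_of_real (\<omega> - \<omega>') * ?v) \<le> \<theta> * (187 / 100)"
      unfolding norm_mult norm_of_real \<theta>_def using v by (intro mult_left_mono) auto
    then show "norm ((?L - ?V) * (of_real (\<omega> - \<omega>') * ?v)) \<le> (3 / 100) * (\<theta> * (187 / 100))"
      unfolding norm_mult[of "?L - ?V"] by (intro mult_mono A.symbol_2_near norm_ge_zero) simp_all
  qed
  also have "\<dots> \<le> (13 / 100) * \<theta>" using theta_nonneg by linarith
  finally show ?thesis .
qed

text \<open>The product of the phases equals 1 + cis (- 3 \<omega>), which is 1 + i at \<omega> =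
  pi/2.\<close>

lemma approx_forcing:
  "norm (of_real (\<alpha>\<^sup>2 * Y) * ((cis \<omega> + cis (- 2 * \<omega>)) * cis (- \<omega>)) - of_real (pi * pi / 4 * Y) * Complex 1 1) \<le> (61 / 1000) * Y"
proof -
  have c3: "cis (- 3 * (pi / 2)) = \<i>"
  proof -
    have "cis (- 3 * (pi / 2)) = cis (pi / 2 + - (2 * pi))" by simp
    also have "\<dots> = cis (pi / 2) * cis (- (2 * pi))" by (simp only: cis_mult)
    finally show ?thesis by (simp add: complex_eq_iff)
  qed
  have "(cis \<omega> + cis (- 2 * \<omega>)) * cis (- \<omega>) = 1 + cis (- 3 * \<omega>)"
    by (simp add: distrib_right cis_mult)
  also have "\<dots> = Complex 1 1 + (cis (- 3 * \<omega>) - cis (- 3 * (pi / 2)))"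
    unfolding c3 by (simp add: complex_eq_iff)
  finally have gc: "(cis \<omega> + cis (- 2 * \<omega>)) * cis (- \<omega>) = Complex 1 1 + (cis (- 3 * \<omega>) - cis (- 3 * (pi / 2)))" .
  have eq: "of_real (\<alpha>\<^sup>2 * Y) * ((cis \<omega> + cis (- 2 * \<omega>)) * cis (- \<omega>)) - of_real (pi * pi / 4 * Y) * Complex 1 1
     = of_real ((\<alpha> * \<alpha> - pi * pi / 4) * Y) * Complex 1 1 + of_real (\<alpha>\<^sup>2 * Y) * (cis (- 3 * \<omega>) - cis (- 3 * (pi / 2)))"
    unfolding gc by (simp add: power2_eq_square algebra_simps)
  have aa: "\<alpha> * \<alpha> \<le> (157633 / 100000) * (157633 / 100000)" using A.alpha_bounds by (intro mult_mono) auto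
  have pp: "(314159 / 100000) * (314159 / 100000) \<le> pi * pi" using pi_approx by (intro mult_mono) auto
  have ap: "(pi / 2) * (pi / 2) \<le> \<alpha> * \<alpha>" using A.alpha_ge A.alpha_bounds pi_gt_zero by (intro mult_mono) auto
  have "(norm (Complex 1 1))\<^sup>2 = 2" by (simp add: cmod_power2)
  also have "\<dots> \<le> (283 / 200)\<^sup>2" by (simp add: power2_eq_square)
  finally have n11: "norm (Complex 1 1) \<le> (283 / 200)" by (rule power2_le_imp_le) simp
  show ?thesis unfolding eq
  proof (rule order_trans[OF norm_triangle_mono])
    have "\<bar>\<alpha> * \<alpha> - pi * pi / 4\<bar> * Y \<le> (7 / 400) * Y"
      using aa pp ap Y_nonneg by (intro mult_right_mono) auto
    then have "norm (complex_of_real ((\<alpha> * \<alpha> - pi * pi / 4) * Y)) \<le> (7 / 400) * Y"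
      using Y_nonneg by (simp only: norm_of_real abs_mult abs_of_nonneg)
    then show "norm (of_real ((\<alpha> * \<alpha> - pi * pi / 4) * Y) * Complex 1 1) \<le> ((7 / 400) * Y) * (283 / 200)"
      unfolding norm_mult[of _ "Complex 1 1"] using n11 Y_nonneg by (intro mult_mono) auto
    have "\<bar>\<alpha>\<^sup>2\<bar> * Y \<le> (497 / 200) * Y"
      using aa Y_nonneg by (intro mult_right_mono) (auto simp: power2_eq_square)
    then have "norm (complex_of_real (\<alpha>\<^sup>2 * Y)) \<le> (497 / 200) * Y"
      using Y_nonneg by (simp only: norm_of_real abs_mult abs_of_nonneg)
    then show "norm (of_real (\<alpha>\<^sup>2 * Y) * (cis (- 3 * \<omega>) - cis (- 3 * (pi / 2)))) \<le> ((497 / 200) * Y) * (\<bar>- 3\<bar> * (47 / 10000))"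
      unfolding norm_mult[of "of_real (\<alpha>\<^sup>2 * Y)"] using Y_nonneg by (intro mult_mono A.norm_cis_omega_le norm_ge_zero) simp_all
    show "((7 / 400) * Y) * (283 / 200) + ((497 / 200) * Y) * (\<bar>- 3\<bar> * (47 / 10000)) \<le> (61 / 1000) * Y"
      using Y_nonneg by simp
  qed
qed

lemma Y_theta_eq_0: "Y = 0" "\<theta> = 0"
proof -
  define s where "s = \<omega> - \<omega>'"
  have s: "\<theta> = \<bar>s\<bar>" by (simp add: s_def \<theta>_def)
  define V where "V = Complex (- (pi / 2)) pi * Complex (- (pi / 2)) 1"
  define u where "u = of_real s * V - of_real (pi * pi / 4 * Y) * Complex 1 1"
  have u: "norm u \<le> (269 / 500) * Y + (1271 / 5000) * \<theta>"
  proof -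
    define p where "p = wright_symbol \<alpha> \<omega> 2 * (wright_symbol \<alpha> \<omega> 1 - wright_symbol \<alpha> \<omega>' 1)"
    define q where "q = of_real (\<alpha>\<^sup>2 * Y) * ((cis \<omega> + cis (- 2 * \<omega>)) * cis (- \<omega>))"
    have "u = (p - q) - (p - of_real s * V) + (q - of_real (pi * pi / 4 * Y) * Complex 1 1)"
      unfolding u_def by (simp only: algebra_simps)
    also have "norm \<dots> \<le> norm (p - q) + norm (p - of_real s * V) + norm (q - of_real (pi * pi / 4 * Y) * Complex 1 1)"
      by (rule order_trans[OF norm_triangle_ineq add_right_mono[OF norm_triangle_ineq4]])
    also have "\<dots> \<le> ((477 / 1000) * Y + (621 / 5000) * \<theta>) + (13 / 100) * \<theta> + (61 / 1000) * Y"
      unfolding V_def s_def p_def q_def by (intro add_mono main_difference approx_product approx_forcing)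
    finally show ?thesis by simp
  qed
  have V: "Re V = pi * pi / 4 - pi" "Im V = - (pi * pi) / 2 - pi / 2"
    by (simp_all add: V_def algebra_simps)
  have pp: "(157 / 50) * (157 / 50) \<le> pi * pi" "pi * pi \<le> (63 / 20) * (63 / 20)" using pi_approx by (intro mult_mono; simp)+
  have V': "- (7 / 10) \<le> Re V" "Re V \<le> 0" "Im V \<le> - (32 / 5)" using V pp pi_approx by simp_all
  have re: "Re u = s * Re V - pi * pi / 4 * Y" and im: "Im u = s * Im V - pi * pi / 4 * Y"
    by (simp_all add: u_def)
  have q: "(123 / 50) * Y \<le> pi * pi / 4 * Y" using pp Y_nonneg by (intro mult_right_mono) auto
  define q where "q = pi * pi / 4 * Y"
  have q: "(123 / 50) * Y \<le> q" using q by (simp only: q_def)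
  have "\<bar>s * Re V - q\<bar> \<le> (269 / 500) * Y + (1271 / 5000) * \<theta>"
    using u abs_Re_le_cmod[of u] unfolding re q_def by linarith
  then have reb: "q - s * Re V \<le> (269 / 500) * Y + (1271 / 5000) * \<theta>" by (simp add: abs_le_iff)
  have "\<bar>s * Im V - q\<bar> \<le> (269 / 500) * Y + (1271 / 5000) * \<theta>"
    using u abs_Im_le_cmod[of u] unfolding im q_def by linarith
  then have imb: "q - s * Im V \<le> (269 / 500) * Y + (1271 / 5000) * \<theta>" "s * Im V - q \<le> (269 / 500) * Y + (1271 / 5000) * \<theta>"
    by (auto simp: abs_le_iff)
  \<comment> \<open>Re V is about -0.67 and Im V about -6.5, while \<open>Y\<close> has the same
    coefficient in both parts. For s \<ge> 0 the two terms of the imaginary part have the same sign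
    and cannot cancel. For s < 0 they could, but the real part bounds \<open>Y\<close> by less than
    |s| / 2, too little to balance the imaginary part.\<close>
  have "Y = 0 \<and> \<theta> = 0"
  proof (cases "0 \<le> s")
    case True
    then have "s * Im V \<le> s * (- (32 / 5))" using V' by (intro mult_left_mono)
    with True imb q Y_nonneg show ?thesis unfolding s by (simp add: abs_of_nonneg) 
  next
    case False
    then have "\<theta> = - s" by (simp add: s)
    moreover from False have "(- s) * Im V \<le> (- s) * (- (32 / 5))" "(- s) * (- (7 / 10)) \<le> (- s) * Re V" 
      using V' by (intro mult_left_mono; simp)+
    ultimately show ?thesis using False reb imb q Y_nonneg by simp
  qed
  then show "Y = 0" "\<theta> = 0" by auto
qed

lemma unique: "\<omega> = \<omega>'" "c = b"
proof -
  show "\<omega> = \<omega>'" using Y_theta_eq_0(2) by (simp add: \<theta>_def)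
  have P: "P = 0" and D: "D = 0" using P_D_le Y_theta_eq_0 D_nonneg by auto
  have e: "\<epsilon> = \<eta>" using Y_theta_eq_0(1) A.eps_nonneg B.eps_nonneg by (simp add: Y_def power2_eq_iff_nonneg)
  show "c = b"
  proof
    fix k :: int
    consider "3 \<le> \<bar>k\<bar>" | "k = 2" | "k = - 2" | "k = 1" | "k = - 1" | "k = 0" by linarith
    then have "d k = 0"
    proof cases
      case 1
      then show ?thesis using le_tail[OF d_summable, of 3 k] D by simp
    qed (use P d_uminus[of 2] d_1 d_m1 e in \<open>auto\<close>)
    then show "c k = b k" by simp
  qed
qed

end

section \<open>Uniqueness\<close>

text \<open>A translation of time by \<phi> / \<omega> has this effect on the modes; in every term
  of the convolution the phases of j and k - j multiply to that of k.\<close>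

lemma wright_coeffs_translate:
  assumes "wright_coeffs \<alpha> \<omega> c"
  shows "wright_coeffs \<alpha> \<omega> (\<lambda>k. c k * cis (of_int k * \<phi>))"
proof -
  have "delay_conv \<omega> (\<lambda>k. c k * cis (of_int k * \<phi>)) k = cis (of_int k * \<phi>) * delay_conv \<omega> c k" for k
  proof -
    have cc: "cis (of_int j * \<phi>) * cis (of_int (k - j) * \<phi>) = cis (of_int k * \<phi>)" for j
      by (simp add: cis_mult algebra_simps)
    have "c j * cis (of_int j * \<phi>) * cis (- of_int j * \<omega>) * (c (k - j) * cis (of_int (k - j) * \<phi>))
        = cis (of_int k * \<phi>) * (c j * cis (- of_int j * \<omega>) * c (k - j))" for j
      unfolding cc[of j, symmetric] by (simp only: mult_ac)
    then show ?thesis unfolding delay_conv_def by (simp only: infsum_cmult_right')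
  qed
  note N = this
  have "wright_symbol \<alpha> \<omega> k * (c k * cis (of_int k * \<phi>)) = - of_real \<alpha> * delay_conv \<omega> (\<lambda>k. c k * cis (of_int k * \<phi>)) k" for k
  proof -
    have "wright_symbol \<alpha> \<omega> k * c k = - of_real \<alpha> * delay_conv \<omega> c k" using assms by (simp add: wright_coeffs_def)
    from arg_cong[OF this, of "\<lambda>z. z * cis (of_int k * \<phi>)"] show ?thesis unfolding N by (simp only: mult_ac)
  qed
  then show ?thesis using assms by (simp add: wright_coeffs_def norm_mult cis_cnj)
qed

context wright_periodic
begin

lemma ex_small_coeffs:
  assumes a: "pi / 2 \<le> \<alpha>" "\<alpha> \<le> pi / 2 + (553 / 100000)" and w: "\<bar>\<omega> - pi / 2\<bar> \<le> (231 / 2500)"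
    and L2: "L2_norm_on {0..2 * pi / \<omega>} (deriv y) \<le> (151 / 500)" and nz: "\<exists>t. y t \<noteq> 0"
  shows "\<exists>\<phi> \<epsilon>. small_coeffs \<alpha> \<omega> \<epsilon> (\<lambda>k. c k * cis (of_int k * \<phi>))"
proof (intro exI)
  \<comment> \<open>The rotation makes the first mode real and nonnegative; if it vanishes, the
    identities below hold with \<epsilon> = 0.\<close>
  define \<phi> where "\<phi> = - Arg (c 1)"
  note s = c_summable_on[OF L2]
  have om: "(147839 / 100000) \<le> \<omega>" using w pi_approx unfolding abs_le_iff by simp
  have B: "(151 / 500)\<^sup>2 / (2 * pi * \<omega>) \<le> (9819 / 1000000)"
  proof -
    have "(314159 / 100000) * (147839 / 100000) \<le> pi * \<omega>" using om pi_approx by (intro mult_mono) auto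
    then show ?thesis using omega by (simp add: field_simps power2_eq_square)
  qed
  show "small_coeffs \<alpha> \<omega> (norm (c 1)) (\<lambda>k. c k * cis (of_int k * \<phi>))"
  proof
    show "wright_coeffs \<alpha> \<omega> (\<lambda>k. c k * cis (of_int k * \<phi>))"
      by (intro wright_coeffs_translate wright_coeffs s)
    have "c 1 = of_real (norm (c 1)) * cis (Arg (c 1))" using rcis_cmod_Arg[of "c 1"] by (simp add: rcis_def)
    then have "c 1 * cis \<phi> = of_real (norm (c 1)) * (cis (Arg (c 1)) * cis \<phi>)" by (metis mult.assoc)
    then show "c 1 * cis (of_int 1 * \<phi>) = of_real (norm (c 1))" by (simp add: \<phi>_def cis_mult)
    have "c (- 1) = cnj (c 1)" using wright_coeffs[OF s] by (simp add: wright_coeffs_def)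
    \<comment> \<open>Both modes 1 and -1 contribute, so the bound 0.009819 is halved before the
      root is taken, which gives 0.0701.\<close>
    then have "2 * (norm (c 1))\<^sup>2 \<le> (151 / 500)\<^sup>2 / (2 * pi * \<omega>)"
      using sum_weighted_squares_le[OF L2, of "{1, - 1}"] by (simp add: power_mult_distrib)
    then have "(norm (c 1))\<^sup>2 \<le> (701 / 10000)\<^sup>2" using B by (simp add: power2_eq_square)
    then show "norm (c 1) \<le> (701 / 10000)" by (rule power2_le_imp_le) simp
    \<comment> \<open>The constant 9/50 is just above the root of 0.009819 pi^2/3.\<close>
    have "infsum (\<lambda>k. norm (c k)) UNIV \<le> (9 / 50)"
    proof (rule infsum_le_finite_sums[OF s])
      fix F :: "int set" assume F: "finite F"
      have c0: "c 0 = 0" using wright_coeffs[OF s] by (simp add: wright_coeffs_def)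
      have "(\<Sum>k\<in>F. norm (c k)) = (\<Sum>k\<in>F - {0}. norm (c k))"
        using F by (intro sum.mono_neutral_right) (auto simp: c0)
      also have "\<dots> \<le> sqrt (pi\<^sup>2 / 3 * ((151 / 500)\<^sup>2 / (2 * pi * \<omega>)))"
        using F by (intro sum_norm_le L2) auto
      also have "\<dots> \<le> (9 / 50)"
      proof (rule real_le_lsqrt)
        have "pi * pi \<le> (3927 / 1250) * (3927 / 1250)" using pi_approx by (intro mult_mono) auto
        then have p: "pi\<^sup>2 / 3 \<le> (329 / 100)" by (simp add: power2_eq_square)
        have "pi\<^sup>2 / 3 * ((151 / 500)\<^sup>2 / (2 * pi * \<omega>)) \<le> (329 / 100) * (9819 / 1000000)"
          using omega by (intro mult_mono[OF p B]) auto
        also have "\<dots> \<le> (9 / 50)\<^sup>2" by (simp add: power2_eq_square)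
        finally show "pi\<^sup>2 / 3 * ((151 / 500)\<^sup>2 / (2 * pi * \<omega>)) \<le> (9 / 50)\<^sup>2" .
      qed (use omega in auto)
      finally show "(\<Sum>k\<in>F. norm (c k)) \<le> (9 / 50)" .
    qed
    then show "(\<Sum>\<^sub>\<infinity>k. norm (c k * cis (of_int k * \<phi>))) \<le> (9 / 50)" by (simp add: norm_mult)
    show "\<exists>k. c k * cis (of_int k * \<phi>) \<noteq> 0"
    proof (rule ccontr)
      assume "\<not> ?thesis"
      then have "c k = 0" for k by simp
      then have "((\<lambda>k. c k * fmode \<omega> k t) has_sum 0) UNIV" for t by (intro has_sum_0) simp
      then have "Y t = 0" for t using has_sum_unique[OF Y_series[OF s, of t]] by blast
      then show False using nz by simp
    qed
  qed (use a w in auto)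
qed

end

theorem theorem4p10:
  fixes \<alpha> \<omega>1 \<omega>2 :: real and y1 y2 :: "real \<Rightarrow> real"
  assumes "\<alpha> \<in> {pi / 2 <.. pi / 2 + 5.53 / 10 ^ 3}"
    and "wright_solution \<alpha> y1" and "\<exists>t. y1 t \<noteq> 0" and "\<forall>t. y1 t > -1"
    and "has_frequency y1 \<omega>1" and "\<bar>\<omega>1 - pi / 2\<bar> \<le> 0.0924"
    and "L2_norm_on {0..2 * pi / \<omega>1} (deriv y1) \<le> 0.302"
    and "wright_solution \<alpha> y2" and "\<exists>t. y2 t \<noteq> 0" and "\<forall>t. y2 t > -1"
    and "has_frequency y2 \<omega>2" and "\<bar>\<omega>2 - pi / 2\<bar> \<le> 0.0924"
    and "L2_norm_on {0..2 * pi / \<omega>2} (deriv y2) \<le> 0.302"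
  shows "\<exists>\<tau>. \<forall>t. y2 t = y1 (t + \<tau>)"
proof -
  have a: "pi / 2 \<le> \<alpha>" "\<alpha> \<le> pi / 2 + (553 / 100000)" "\<alpha> \<noteq> 0" using assms(1) pi_gt_zero by auto
  have w: "\<bar>\<omega>1 - pi / 2\<bar> \<le> (231 / 2500)" "\<bar>\<omega>2 - pi / 2\<bar> \<le> (231 / 2500)"
    and l: "L2_norm_on {0..2 * pi / \<omega>1} (deriv y1) \<le> (151 / 500)" "L2_norm_on {0..2 * pi / \<omega>2} (deriv y2) \<le> (151 / 500)"
    using assms(6,12,7,13) by simp_all
  interpret S1: wright_periodic \<alpha> \<omega>1 y1 using a(3) assms(2,4,5) by unfold_locales auto
  interpret S2: wright_periodic \<alpha> \<omega>2 y2 using a(3) assms(8,10,11) by unfold_locales auto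
  obtain \<phi>1 \<epsilon>1 where 1: "small_coeffs \<alpha> \<omega>1 \<epsilon>1 (\<lambda>k. S1.c k * cis (of_int k * \<phi>1))"
    using S1.ex_small_coeffs[OF a(1,2) w(1) l(1) assms(3)] by blast
  obtain \<phi>2 \<epsilon>2 where 2: "small_coeffs \<alpha> \<omega>2 \<epsilon>2 (\<lambda>k. S2.c k * cis (of_int k * \<phi>2))"
    using S2.ex_small_coeffs[OF a(1,2) w(2) l(2) assms(9)] by blast
  have eq: "\<omega>1 = \<omega>2" "(\<lambda>k. S1.c k * cis (of_int k * \<phi>1)) = (\<lambda>k. S2.c k * cis (of_int k * \<phi>2))"
  proof -
    have "\<omega>1 = \<omega>2 \<and> (\<lambda>k. S1.c k * cis (of_int k * \<phi>1)) = (\<lambda>k. S2.c k * cis (of_int k * \<phi>2))"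
    \<comment> \<open>The comparison wants the larger amplitude in the first place, so the roles are
      exchanged in the second case.\<close>
    proof (cases "\<epsilon>2 \<le> \<epsilon>1")
      case True
      with 1 2 have p: "small_coeffs_pair \<alpha> \<omega>1 \<omega>2 \<epsilon>1 \<epsilon>2 (\<lambda>k. S1.c k * cis (of_int k * \<phi>1)) (\<lambda>k. S2.c k * cis (of_int k * \<phi>2))"
        by (simp add: small_coeffs_pair_def small_coeffs_pair_axioms_def)
      show ?thesis using small_coeffs_pair.unique[OF p] by simp
    next
      case False
      with 1 2 have p: "small_coeffs_pair \<alpha> \<omega>2 \<omega>1 \<epsilon>2 \<epsilon>1 (\<lambda>k. S2.c k * cis (of_int k * \<phi>2)) (\<lambda>k. S1.c k * cis (of_int k * \<phi>1))"
        by (simp add: small_coeffs_pair_def small_coeffs_pair_axioms_def)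
      show ?thesis using small_coeffs_pair.unique[OF p] by simp
    qed
    then show "\<omega>1 = \<omega>2" "(\<lambda>k. S1.c k * cis (of_int k * \<phi>1)) = (\<lambda>k. S2.c k * cis (of_int k * \<phi>2))" by auto
  qed
  \<comment> \<open>The coefficients of \<open>y2\<close> are those of \<open>y1\<close> times cis
    (k (\<phi>1 - \<phi>2)), which is a time shift by the phase difference over the common
    frequency. Fourier inversion carries this back to the functions.\<close>
  define \<tau> where "\<tau> = (\<phi>1 - \<phi>2) / \<omega>1"
  have "y2 t = y1 (t + \<tau>)" for t
  proof -
    have "S2.c k * fmode \<omega>2 k t = S1.c k * fmode \<omega>1 k (t + \<tau>)" for k
    proof -
      have "S1.c k * cis (of_int k * \<phi>1) * cis (- of_int k * \<phi>2) = S2.c k * (cis (of_int k * \<phi>2) * cis (- of_int k * \<phi>2))"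
        using fun_cong[OF eq(2), of k] by (simp only: mult.assoc)
      then have c2: "S2.c k = S1.c k * (cis (of_int k * \<phi>1) * cis (- of_int k * \<phi>2))" by (simp add: cis_mult mult.assoc)
      have "of_int k * \<omega>1 * (t + \<tau>) = of_int k * \<phi>1 + - of_int k * \<phi>2 + of_int k * \<omega>2 * t"
        using S1.omega by (simp add: \<tau>_def field_simps flip: eq(1))
      then have "fmode \<omega>1 k (t + \<tau>) = cis (of_int k * \<phi>1) * cis (- of_int k * \<phi>2) * fmode \<omega>2 k t"
        by (simp only: fmode_def cis_mult)
      then show ?thesis unfolding c2 by (simp only: mult.assoc)
    qed
    then have "((\<lambda>k. S2.c k * fmode \<omega>2 k t) has_sum S1.Y (t + \<tau>)) UNIV"
      using S1.Y_series[OF S1.c_summable_on[OF assms(7)], of "t + \<tau>"] by simp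
    then have "S2.Y t = S1.Y (t + \<tau>)"
      using S2.Y_series[OF S2.c_summable_on[OF assms(13)], of t] has_sum_unique by blast
    then show ?thesis by simp
  qed
  then show ?thesis by blast
qed

end
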